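(* Let $\{E^*_H\}_H$ be equivariant cohomology theories, let $G$ be a compact Lie group, $n$ a positive integer and $m$ an integer. For each $\sigma\in G^n_z$ let $E_{\Lambda_G(\sigma),n,m}$ denote a space representing the $m$-th $\Lambda_G(\sigma)$-equivariant $E$-theory $E^m_{\Lambda_G(\sigma)}(-)$. Then the theory $QE^m_{n,G}$ is weakly represented by the $G$-space $$QE_{G,n,m}:=\prod_{\sigma\in G^n_z}\mathcal{R}_\sigma(E_{\Lambda_G(\sigma),n,m}),\qquad \mathcal{R}_\sigma(E_{\Lambda_G(\sigma),n,m})=\mathrm{Map}_{C_G(\sigma)}\big(G,\,E_{\Lambda_G(\sigma),n,m}^{\mathbb{R}^n}* S_{C_G(\sigma),\sigma}\big),$$ in the sense that $$\pi_0^G(QE_{G,n,m})=QE^m_{n,G}(S^0).$$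
   Context: $G^{tors}_{conj}$ is a set of representatives of the $G$-conjugacy classes of torsion elements of $G$, and $G^n_z=\{\sigma=(\sigma_1,\dots,\sigma_n):\sigma_i\in G^{tors}_{conj},\ \sigma_i\sigma_j=\sigma_j\sigma_i\}$. For $\sigma\in G^n_z$: $\Gamma=\langle\sigma_1,\dots,\sigma_n\rangle$ (a finite abelian group), $C_G(\sigma)=\bigcap_iC_G(\sigma_i)$, and $\Lambda_G(\sigma)=C_G(\sigma)\times\mathbb{R}^n/\langle(\sigma_1,-e_1),\dots,(\sigma_n,-e_n)\rangle$, where $e_1,\dots,e_n$ is the standard basis. The subgroup $\{[1,t]:t\in\mathbb{R}^n\}$ of $\Lambda_G(\sigma)$ is denoted $\mathbb{R}^n$, and $Y^{\mathbb{R}^n}$ is its fixed-point space in a $\Lambda_G(\sigma)$-space $Y$, a $C_G(\sigma)$-space. $X^\sigma$ is the subspace of a $G$-space $X$ fixed by all $\sigma_i$, with $\Lambda_G(\sigma)$-action $[g,t]x=gx$. Quasi-theory: $QE^m_{n,G}(X)=\prod_{\sigma\in G^n_z}E^m_{\Lambda_G(\sigma)}(X^\sigma)$. The value on $S^0$ is the reduced value, i.e. $\prod_{\sigma}E^m_{\Lambda_G(\sigma)}(\mathrm{pt})$ in unreduced terms. A $\Lambda$-space $Y$ represents $E^m_\Lambda$ if $E^m_\Lambda(X)\cong[X,Y]^\Lambda$ naturally for $\Lambda$-CW complexes $X$. For $K\le G$, $\mathrm{Map}_K(G,Y)$ is the space of maps with $f(kg)=kf(g)$ and $G$-action $(g\cdot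 f)(x)=f(xg)$. $*$ denotes the join (with $Y*\emptyset=Y$). $S_{C_G(\sigma),\sigma}=\mathrm{Map}_\Gamma\big(C_G(\sigma),*_{K}E(\Gamma/K)\big)$, where $K$ runs over all maximal (proper) subgroups of $\Gamma$ and $E(\Gamma/K)$ is the universal space (contractible with free action) of $\Gamma/K$. $\pi_0^G(Y)=\pi_0(Y^G)$. *)

theory Defs
  imports "HOL-Analysis.Analysis" "HOL-Algebra.Product_Groups"
begin

section \<open>Quotient topologies\<close>

definition quotient_topology :: "'a topology \<Rightarrow> ('a \<Rightarrow> 'b) \<Rightarrow> 'b topology" where
  "quotient_topology X q =
     topology (\<lambda>U. U \<subseteq> q ` topspace X \<and> openin X {x \<in> topspace X. q x \<in> U})"

lemma istopology_subset: "istopology (\<lambda>U. U \<subseteq> Z)"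
  by (auto simp: istopology_def)

lemma istopology_preimage: "istopology (\<lambda>U. openin X {x \<in> topspace X. q x \<in> U})"
proof -
  have 1: "{x \<in> topspace X. q x \<in> S \<inter> T} = {x \<in> topspace X. q x \<in> S} \<inter> {x \<in> topspace X. q x \<in> T}"
    for S T by auto
  have 2: "{x \<in> topspace X. q x \<in> \<Union>\<K>} = (\<Union>K\<in>\<K>. {x \<in> topspace X. q x \<in> K})" for \<K>
    by auto
  show ?thesis
    unfolding istopology_def 1 2 by (auto intro!: openin_Union)
qed

lemma istopology_conj:
  assumes "istopology P" "istopology Q"
  shows "istopology (\<lambda>U. P U \<and> Q U)"
  using assms by (simp add: istopology_def)

lemma istopology_all:
  assumes "\<And>i. i \<in> I \<Longrightarrow> istopology (P i)"
  shows "istopology (\<lambda>U. \<forall>i\<in>I. P i U)"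
  using assms by (simp add: istopology_def)

lemma openin_quotient_topology:
  "openin (quotient_topology X q) U \<longleftrightarrow>
     U \<subseteq> q ` topspace X \<and> openin X {x \<in> topspace X. q x \<in> U}"
  unfolding quotient_topology_def
  by (subst topology_inverse') (auto intro!: istopology_conj istopology_subset istopology_preimage)


section \<open>Topological groups and compact Lie groups\<close>

record 'g topgrp = "'g monoid" +
  gtop :: "'g topology"

definition topological_group :: "'g topgrp \<Rightarrow> bool" where
  "topological_group G \<longleftrightarrow> group G \<and> topspace (gtop G) = carrier G \<and>
     continuous_map (prod_topology (gtop G) (gtop G)) (gtop G) (\<lambda>(x, y). x \<otimes>\<^bsub>G\<^esub> y) \<and>
     continuous_map (gtop G) (gtop G) (\<lambda>x. inv\<^bsub>G\<^esub> x)"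

text \<open>Smoothness on an open subset S of \<open>Euclidean_space d\<close> (real sequences vanishing from index d
  on): all iterated partial derivatives exist and are continuous. The case \<open>d = 0\<close> is included, so
  that finite groups are Lie groups.\<close>

definition partial_deriv :: "nat \<Rightarrow> ((nat \<Rightarrow> real) \<Rightarrow> real) \<Rightarrow> (nat \<Rightarrow> real) \<Rightarrow> real" where
  "partial_deriv i f x = deriv (\<lambda>t. f (x(i := t))) (x i)"

definition smooth_on :: "nat \<Rightarrow> (nat \<Rightarrow> real) set \<Rightarrow> ((nat \<Rightarrow> real) \<Rightarrow> real) \<Rightarrow> bool" where
  "smooth_on d S f \<longleftrightarrow>
     (\<forall>js. set js \<subseteq> {..<d} \<longrightarrow>
        continuous_map (subtopology (Euclidean_space d) S) euclideanreal (foldr partial_deriv js f) \<and>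
        (\<forall>i<d. \<forall>x\<in>S. (\<lambda>t. foldr partial_deriv js f (x(i := t))) differentiable (at (x i))))"

definition smooth_map :: "nat \<Rightarrow> nat \<Rightarrow> (nat \<Rightarrow> real) set \<Rightarrow> ((nat \<Rightarrow> real) \<Rightarrow> nat \<Rightarrow> real) \<Rightarrow> bool" where
  "smooth_map d e S F \<longleftrightarrow>
     openin (Euclidean_space d) S \<and> (\<forall>j<e. smooth_on d S (\<lambda>x. F x j))"

definition fst_coords :: "nat \<Rightarrow> (nat \<Rightarrow> real) \<Rightarrow> nat \<Rightarrow> real" where
  "fst_coords d c = (\<lambda>i. if i < d then c i else 0)"

definition snd_coords :: "nat \<Rightarrow> (nat \<Rightarrow> real) \<Rightarrow> nat \<Rightarrow> real" where
  "snd_coords d c = (\<lambda>i. c (i + d))"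

definition lie_atlas :: "'g topgrp \<Rightarrow> nat \<Rightarrow> ('g set \<times> ('g \<Rightarrow> nat \<Rightarrow> real)) set \<Rightarrow> bool" where
  "lie_atlas G d \<A> \<longleftrightarrow>
     (\<Union>(U, \<phi>)\<in>\<A>. U) = carrier G \<and>
     (\<forall>(U, \<phi>)\<in>\<A>. openin (gtop G) U \<and> openin (Euclidean_space d) (\<phi> ` U) \<and>
        homeomorphic_map (subtopology (gtop G) U) (subtopology (Euclidean_space d) (\<phi> ` U)) \<phi>) \<and>
     (\<forall>(U, \<phi>)\<in>\<A>. \<forall>(V, \<psi>)\<in>\<A>.
        smooth_map d d (\<phi> ` (U \<inter> V)) (\<lambda>a. \<psi> (inv_into U \<phi> a))) \<and>
     (\<forall>(U, \<phi>)\<in>\<A>. \<forall>(V, \<psi>)\<in>\<A>.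
        smooth_map d d (\<phi> ` {x \<in> U. inv\<^bsub>G\<^esub> x \<in> V}) (\<lambda>a. \<psi> (inv\<^bsub>G\<^esub> (inv_into U \<phi> a)))) \<and>
     (\<forall>(U, \<phi>)\<in>\<A>. \<forall>(V, \<psi>)\<in>\<A>. \<forall>(W, \<theta>)\<in>\<A>.
        smooth_map (d + d) d
          {c \<in> topspace (Euclidean_space (d + d)).
             \<exists>x\<in>U. \<exists>y\<in>V. fst_coords d c = \<phi> x \<and> snd_coords d c = \<psi> y \<and> x \<otimes>\<^bsub>G\<^esub> y \<in> W}
          (\<lambda>c. \<theta> (inv_into U \<phi> (fst_coords d c) \<otimes>\<^bsub>G\<^esub> inv_into V \<psi> (snd_coords d c))))"

definition compact_lie_group :: "'g topgrp \<Rightarrow> bool" where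
  "compact_lie_group G \<longleftrightarrow> topological_group G \<and> compact_space (gtop G) \<and>
     Hausdorff_space (gtop G) \<and> second_countable (gtop G) \<and> (\<exists>d \<A>. lie_atlas G d \<A>)"

definition sub_topgrp :: "'g topgrp \<Rightarrow> 'g set \<Rightarrow> 'g topgrp" where
  "sub_topgrp G S = G\<lparr>carrier := S, gtop := subtopology (gtop G) S\<rparr>"

definition prod_topgrp :: "'g topgrp \<Rightarrow> 'h topgrp \<Rightarrow> ('g \<times> 'h) topgrp" where
  "prod_topgrp G H = \<lparr>carrier = carrier (G \<times>\<times> H), mult = mult (G \<times>\<times> H), one = one (G \<times>\<times> H),
     gtop = prod_topology (gtop G) (gtop H)\<rparr>"

definition quotient_topgrp :: "'g topgrp \<Rightarrow> 'g set \<Rightarrow> 'g set topgrp" where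
  "quotient_topgrp G N = \<lparr>carrier = carrier (G Mod N), mult = mult (G Mod N), one = one (G Mod N),
     gtop = quotient_topology (gtop G) (\<lambda>g. N #>\<^bsub>G\<^esub> g)\<rparr>"

definition Rn_group :: "nat \<Rightarrow> (nat \<Rightarrow> real) topgrp" where
  "Rn_group n = \<lparr>carrier = topspace (Euclidean_space n), mult = (\<lambda>s t i. s i + t i), one = (\<lambda>i. 0),
     gtop = Euclidean_space n\<rparr>"


section \<open>Spaces with a group action\<close>

record ('g, 'x) gspace =
  sp :: "'x topology"
  act :: "'g \<Rightarrow> 'x \<Rightarrow> 'x"

definition is_gspace :: "'g topgrp \<Rightarrow> ('g, 'x) gspace \<Rightarrow> bool" where
  "is_gspace G X \<longleftrightarrow>
     continuous_map (prod_topology (gtop G) (sp X)) (sp X) (\<lambda>(g, x). act X g x) \<and>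
     (\<forall>x\<in>topspace (sp X). act X \<one>\<^bsub>G\<^esub> x = x) \<and>
     (\<forall>g\<in>carrier G. \<forall>h\<in>carrier G. \<forall>x\<in>topspace (sp X).
        act X (g \<otimes>\<^bsub>G\<^esub> h) x = act X g (act X h x))"

definition equivariant :: "'g topgrp \<Rightarrow> ('g, 'x) gspace \<Rightarrow> ('g, 'y) gspace \<Rightarrow> ('x \<Rightarrow> 'y) \<Rightarrow> bool" where
  "equivariant G X Y f \<longleftrightarrow>
     (\<forall>g\<in>carrier G. \<forall>x\<in>topspace (sp X). f (act X g x) = act Y g (f x))"

definition gmap :: "'g topgrp \<Rightarrow> ('g, 'x) gspace \<Rightarrow> ('g, 'y) gspace \<Rightarrow> ('x \<Rightarrow> 'y) \<Rightarrow> bool" where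
  "gmap G X Y f \<longleftrightarrow> continuous_map (sp X) (sp Y) f \<and> equivariant G X Y f"

definition gsub :: "('g, 'x) gspace \<Rightarrow> 'x set \<Rightarrow> ('g, 'x) gspace" where
  "gsub X A = X\<lparr>sp := subtopology (sp X) A\<rparr>"

definition fixed_points :: "'g set \<Rightarrow> ('g, 'x) gspace \<Rightarrow> 'x set" where
  "fixed_points S X = {x \<in> topspace (sp X). \<forall>g\<in>S. act X g x = x}"

text \<open>Equivariant homotopy classes; \<open>ghclass G X Y f\<close> is the class of f and \<open>ghclasses G X Y\<close>
  is \<open>[X, Y]\<close> in the equivariant sense.\<close>

definition ghclass :: "'g topgrp \<Rightarrow> ('g, 'x) gspace \<Rightarrow> ('g, 'y) gspace \<Rightarrow> ('x \<Rightarrow> 'y) \<Rightarrow> ('x \<Rightarrow> 'y) set" where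
  "ghclass G X Y f = {f'. homotopic_with (equivariant G X Y) (sp X) (sp Y) f f'}"

definition ghclasses :: "'g topgrp \<Rightarrow> ('g, 'x) gspace \<Rightarrow> ('g, 'y) gspace \<Rightarrow> ('x \<Rightarrow> 'y) set set" where
  "ghclasses G X Y = ghclass G X Y ` {f. gmap G X Y f}"

definition pi0_fixed :: "'g topgrp \<Rightarrow> ('g, 'x) gspace \<Rightarrow> 'x set set" where
  "pi0_fixed G X = path_components_of (subtopology (sp X) (fixed_points (carrier G) X))"


section \<open>Equivariant CW complexes\<close>

text \<open>The equivariant k-cells of a complex X are indexed by a set of points of X, which is no loss
  of generality (choose a point in each open cell). The cell j has type \<open>G/K \<times> D\<^sup>k\<close> with
  \<open>K = stab k j\<close> and characteristic map \<open>chr k j\<close>.\<close>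

record ('g, 'x) gcells =
  cells :: "nat \<Rightarrow> 'x set"
  stab :: "nat \<Rightarrow> 'x \<Rightarrow> 'g set"
  chr :: "nat \<Rightarrow> 'x \<Rightarrow> 'g set \<times> (nat \<Rightarrow> real) \<Rightarrow> 'x"

definition disc :: "nat \<Rightarrow> (nat \<Rightarrow> real) topology" where
  "disc k = subtopology (Euclidean_space k) {v. (\<Sum>i<k. (v i)\<^sup>2) \<le> 1}"

definition open_disc :: "nat \<Rightarrow> (nat \<Rightarrow> real) set" where
  "open_disc k = {v \<in> topspace (Euclidean_space k). (\<Sum>i<k. (v i)\<^sup>2) < 1}"

definition boundary_sphere :: "nat \<Rightarrow> (nat \<Rightarrow> real) set" where
  "boundary_sphere k = {v \<in> topspace (Euclidean_space k). (\<Sum>i<k. (v i)\<^sup>2) = 1}"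

definition left_cosets :: "'g topgrp \<Rightarrow> 'g set \<Rightarrow> 'g set set" where
  "left_cosets G K = (\<lambda>g. g <#\<^bsub>G\<^esub> K) ` carrier G"

definition cell_top :: "'g topgrp \<Rightarrow> 'g set \<Rightarrow> nat \<Rightarrow> ('g set \<times> (nat \<Rightarrow> real)) topology" where
  "cell_top G K k = prod_topology (quotient_topology (gtop G) (\<lambda>g. g <#\<^bsub>G\<^esub> K)) (disc k)"

definition open_cell :: "'g topgrp \<Rightarrow> ('g, 'x) gcells \<Rightarrow> nat \<Rightarrow> 'x \<Rightarrow> 'x set" where
  "open_cell G c k j = chr c k j ` (left_cosets G (stab c k j) \<times> open_disc k)"

text \<open>The last condition says that X is a quotient of the disjoint union of its cells.\<close>

definition is_gcw :: "'g topgrp \<Rightarrow> ('g, 'x) gspace \<Rightarrow> ('g, 'x) gcells \<Rightarrow> bool" where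
  "is_gcw G X c \<longleftrightarrow> is_gspace G X \<and>
     (\<forall>k. \<forall>j\<in>cells c k.
        subgroup (stab c k j) G \<and> closedin (gtop G) (stab c k j) \<and>
        continuous_map (cell_top G (stab c k j) k) (sp X) (chr c k j) \<and>
        (\<forall>g\<in>carrier G. \<forall>a\<in>carrier G. \<forall>v\<in>topspace (disc k).
           chr c k j ((g \<otimes>\<^bsub>G\<^esub> a) <#\<^bsub>G\<^esub> stab c k j, v) =
             act X g (chr c k j (a <#\<^bsub>G\<^esub> stab c k j, v))) \<and>
        chr c k j ` (left_cosets G (stab c k j) \<times> boundary_sphere k)
          \<subseteq> (\<Union>l<k. \<Union>i\<in>cells c l. open_cell G c l i)) \<and>
     bij_betw (\<lambda>(k, j, p). chr c k j p)
       (SIGMA k:UNIV. SIGMA j:cells c k. left_cosets G (stab c k j) \<times> open_disc k)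
       (topspace (sp X)) \<and>
     (\<forall>U. U \<subseteq> topspace (sp X) \<and>
        (\<forall>k. \<forall>j\<in>cells c k. openin (cell_top G (stab c k j) k)
           {p \<in> topspace (cell_top G (stab c k j) k). chr c k j p \<in> U})
        \<longrightarrow> openin (sp X) U)"

definition subcomplex :: "'g topgrp \<Rightarrow> ('g, 'x) gspace \<Rightarrow> ('g, 'x) gcells \<Rightarrow> 'x set \<Rightarrow> bool" where
  "subcomplex G X c A \<longleftrightarrow> closedin (sp X) A \<and>
     (\<forall>k. \<forall>j\<in>cells c k. open_cell G c k j \<subseteq> A \<or> open_cell G c k j \<inter> A = {})"

definition gcw_complex :: "'g topgrp \<Rightarrow> ('g, 'x) gspace \<Rightarrow> bool" where
  "gcw_complex G X \<longleftrightarrow> (\<exists>c. is_gcw G X c)"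

definition gcw_pair :: "'g topgrp \<Rightarrow> ('g, 'x) gspace \<times> 'x set \<Rightarrow> bool" where
  "gcw_pair G P \<longleftrightarrow> (\<exists>c. is_gcw G (fst P) c \<and> subcomplex G (fst P) c (snd P))"

definition gpair_map :: "'g topgrp \<Rightarrow> ('g, 'x) gspace \<times> 'x set \<Rightarrow> ('g, 'x) gspace \<times> 'x set
    \<Rightarrow> ('x \<Rightarrow> 'x) \<Rightarrow> bool" where
  "gpair_map G P Q f \<longleftrightarrow> gcw_pair G P \<and> gcw_pair G Q \<and>
     gmap G (fst P) (fst Q) f \<and> f ` snd P \<subseteq> snd Q"


section \<open>Equivariant cohomology theories\<close>

text \<open>Integer-graded theories on pairs of G-CW complexes whose points lie in the (arbitrary) type
  \<open>'x\<close>: groups \<open>grp k (X, A)\<close>, induced maps \<open>ind k P Q f : grp k Q \<rightarrow> grp k P\<close> for \<open>f : P \<rightarrow> Q\<close>, and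
  connecting maps \<open>bd k (X, A) : grp k A \<rightarrow> grp (k + 1) (X, A)\<close>. The abelian groups are written
  multiplicatively.\<close>

record ('g, 'x, 'e) cohomology =
  grp :: "int \<Rightarrow> ('g, 'x) gspace \<times> 'x set \<Rightarrow> 'e monoid"
  ind :: "int \<Rightarrow> ('g, 'x) gspace \<times> 'x set \<Rightarrow> ('g, 'x) gspace \<times> 'x set \<Rightarrow> ('x \<Rightarrow> 'x) \<Rightarrow> 'e \<Rightarrow> 'e"
  bd :: "int \<Rightarrow> ('g, 'x) gspace \<times> 'x set \<Rightarrow> 'e \<Rightarrow> 'e"

locale equivariant_cohomology_theory =
  fixes G :: "'g topgrp" and E :: "('g, 'x, 'e) cohomology"
  assumes abelian_groups: "gcw_pair G P \<Longrightarrow> comm_group (grp E k P)"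
    and ind_hom: "gpair_map G P Q f \<Longrightarrow> ind E k P Q f \<in> hom (grp E k Q) (grp E k P)"
    and ind_id: "gcw_pair G P \<Longrightarrow> z \<in> carrier (grp E k P) \<Longrightarrow> ind E k P P (\<lambda>x. x) z = z"
    and ind_comp: "gpair_map G P Q f \<Longrightarrow> gpair_map G Q R h \<Longrightarrow> z \<in> carrier (grp E k R) \<Longrightarrow>
        ind E k P R (h \<circ> f) z = ind E k P Q f (ind E k Q R h z)"
    and homotopy: "gpair_map G (X, A) (Y, B) f \<Longrightarrow> gpair_map G (X, A) (Y, B) h \<Longrightarrow>
        homotopic_with (\<lambda>u. equivariant G X Y u \<and> u ` A \<subseteq> B) (sp X) (sp Y) f h \<Longrightarrow>
        z \<in> carrier (grp E k (Y, B)) \<Longrightarrow>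
        ind E k (X, A) (Y, B) f z = ind E k (X, A) (Y, B) h z"
    and bd_hom: "gcw_pair G (X, A) \<Longrightarrow>
        bd E k (X, A) \<in> hom (grp E k (gsub X A, {})) (grp E (k + 1) (X, A))"
    and bd_natural: "gpair_map G (X, A) (Y, B) f \<Longrightarrow> z \<in> carrier (grp E k (gsub Y B, {})) \<Longrightarrow>
        bd E k (X, A) (ind E k (gsub X A, {}) (gsub Y B, {}) f z) =
        ind E (k + 1) (X, A) (Y, B) f (bd E k (Y, B) z)"
    and exact_total: "gcw_pair G (X, A) \<Longrightarrow>
        ind E k (X, {}) (X, A) (\<lambda>x. x) ` carrier (grp E k (X, A)) =
        kernel (grp E k (X, {})) (grp E k (gsub X A, {})) (ind E k (gsub X A, {}) (X, {}) (\<lambda>x. x))"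
    and exact_sub: "gcw_pair G (X, A) \<Longrightarrow>
        ind E k (gsub X A, {}) (X, {}) (\<lambda>x. x) ` carrier (grp E k (X, {})) =
        kernel (grp E k (gsub X A, {})) (grp E (k + 1) (X, A)) (bd E k (X, A))"
    and exact_rel: "gcw_pair G (X, A) \<Longrightarrow>
        bd E k (X, A) ` carrier (grp E k (gsub X A, {})) =
        kernel (grp E (k + 1) (X, A)) (grp E (k + 1) (X, {})) (ind E (k + 1) (X, {}) (X, A) (\<lambda>x. x))"
    and excision: "is_gcw G X c \<Longrightarrow> subcomplex G X c A \<Longrightarrow> subcomplex G X c B \<Longrightarrow>
        A \<union> B = topspace (sp X) \<Longrightarrow>
        ind E k (gsub X B, A \<inter> B) (X, A) (\<lambda>x. x) \<in> iso (grp E k (X, A)) (grp E k (gsub X B, A \<inter> B))"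
    and additivity: "is_gcw G X c \<Longrightarrow> (\<And>U. U \<in> \<U> \<Longrightarrow> subcomplex G X c U) \<Longrightarrow> disjoint \<U> \<Longrightarrow>
        \<Union>\<U> = topspace (sp X) \<Longrightarrow>
        bij_betw (\<lambda>z. \<lambda>U\<in>\<U>. ind E k (gsub X U, {}) (X, {}) (\<lambda>x. x) z)
          (carrier (grp E k (X, {}))) (\<Pi>\<^sub>E U\<in>\<U>. carrier (grp E k (gsub X U, {})))"

text \<open>\<open>\<rho>\<close> is a natural isomorphism exhibiting the G-space Y as a representing space of the m-th
  group of E.\<close>

definition represents :: "'g topgrp \<Rightarrow> ('g, 'x, 'e) cohomology \<Rightarrow> int \<Rightarrow> ('g, 'y) gspace
    \<Rightarrow> (('g, 'x) gspace \<Rightarrow> ('x \<Rightarrow> 'y) set \<Rightarrow> 'e) \<Rightarrow> bool" where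
  "represents G E m Y \<rho> \<longleftrightarrow> is_gspace G Y \<and>
     (\<forall>X. gcw_complex G X \<longrightarrow> bij_betw (\<rho> X) (ghclasses G X Y) (carrier (grp E m (X, {})))) \<and>
     (\<forall>X X' f h. gcw_complex G X \<longrightarrow> gcw_complex G X' \<longrightarrow> gmap G X' X f \<longrightarrow> gmap G X Y h \<longrightarrow>
        \<rho> X' (ghclass G X' Y (h \<circ> f)) = ind E m (X', {}) (X, {}) f (\<rho> X (ghclass G X Y h)))"


section \<open>The groups attached to commuting torsion elements\<close>

definition torsion_elements :: "'g topgrp \<Rightarrow> 'g set" where
  "torsion_elements G = {x \<in> carrier G. \<exists>k>0. x [^]\<^bsub>G\<^esub> (k::nat) = \<one>\<^bsub>G\<^esub>}"

definition torsion_conj_reps :: "'g topgrp \<Rightarrow> 'g set \<Rightarrow> bool" where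
  "torsion_conj_reps G R \<longleftrightarrow> R \<subseteq> torsion_elements G \<and>
     (\<forall>x\<in>torsion_elements G. \<exists>!r. r \<in> R \<and> (\<exists>g\<in>carrier G. r = g \<otimes>\<^bsub>G\<^esub> x \<otimes>\<^bsub>G\<^esub> inv\<^bsub>G\<^esub> g))"

text \<open>Tuples are indexed by \<open>0, \<dots>, n - 1\<close>.\<close>

definition Gnz :: "'g topgrp \<Rightarrow> 'g set \<Rightarrow> nat \<Rightarrow> (nat \<Rightarrow> 'g) set" where
  "Gnz G R n = {\<sigma> \<in> {..<n} \<rightarrow>\<^sub>E R. \<forall>i<n. \<forall>j<n. \<sigma> i \<otimes>\<^bsub>G\<^esub> \<sigma> j = \<sigma> j \<otimes>\<^bsub>G\<^esub> \<sigma> i}"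

definition centr :: "'g topgrp \<Rightarrow> nat \<Rightarrow> (nat \<Rightarrow> 'g) \<Rightarrow> 'g topgrp" where
  "centr G n \<sigma> = sub_topgrp G {g \<in> carrier G. \<forall>i<n. g \<otimes>\<^bsub>G\<^esub> \<sigma> i = \<sigma> i \<otimes>\<^bsub>G\<^esub> g}"

definition Gam :: "'g topgrp \<Rightarrow> nat \<Rightarrow> (nat \<Rightarrow> 'g) \<Rightarrow> 'g topgrp" where
  "Gam G n \<sigma> = sub_topgrp G (generate G (\<sigma> ` {..<n}))"

definition Lam_cover :: "'g topgrp \<Rightarrow> nat \<Rightarrow> (nat \<Rightarrow> 'g) \<Rightarrow> ('g \<times> (nat \<Rightarrow> real)) topgrp" where
  "Lam_cover G n \<sigma> = prod_topgrp (centr G n \<sigma>) (Rn_group n)"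

definition Lam_ker :: "'g topgrp \<Rightarrow> nat \<Rightarrow> (nat \<Rightarrow> 'g) \<Rightarrow> ('g \<times> (nat \<Rightarrow> real)) set" where
  "Lam_ker G n \<sigma> = generate (Lam_cover G n \<sigma>) {(\<sigma> i, \<lambda>j. if j = i then - 1 else 0) |i. i < n}"

definition Lam :: "'g topgrp \<Rightarrow> nat \<Rightarrow> (nat \<Rightarrow> 'g) \<Rightarrow> ('g \<times> (nat \<Rightarrow> real)) set topgrp" where
  "Lam G n \<sigma> = quotient_topgrp (Lam_cover G n \<sigma>) (Lam_ker G n \<sigma>)"

definition Lam_class :: "'g topgrp \<Rightarrow> nat \<Rightarrow> (nat \<Rightarrow> 'g) \<Rightarrow> 'g \<Rightarrow> (nat \<Rightarrow> real) \<Rightarrow> ('g \<times> (nat \<Rightarrow> real)) set" where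
  "Lam_class G n \<sigma> g t = Lam_ker G n \<sigma> #>\<^bsub>Lam_cover G n \<sigma>\<^esub> (g, t)"

text \<open>The subspace of X fixed by all \<open>\<sigma> i\<close>, on which the class of \<open>(g, t)\<close> acts as g does; the
  action does not depend on the chosen representative.\<close>

definition fix_sigma :: "nat \<Rightarrow> (nat \<Rightarrow> 'g) \<Rightarrow> ('g, 'x) gspace
    \<Rightarrow> (('g \<times> (nat \<Rightarrow> real)) set, 'x) gspace" where
  "fix_sigma n \<sigma> X =
     \<lparr>sp = subtopology (sp X) (fixed_points (\<sigma> ` {..<n}) X),
      act = (\<lambda>c. act X (fst (SOME p. p \<in> c)))\<rparr>"

text \<open>The fixed points of \<open>{[1, t] | t \<in> \<real>\<^sup>n}\<close> in a \<open>Lam G n \<sigma>\<close>-space, as a \<open>centr G n \<sigma>\<close>-space.\<close>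

definition fix_Rn :: "'g topgrp \<Rightarrow> nat \<Rightarrow> (nat \<Rightarrow> 'g) \<Rightarrow> (('g \<times> (nat \<Rightarrow> real)) set, 'y) gspace
    \<Rightarrow> ('g, 'y) gspace" where
  "fix_Rn G n \<sigma> Y =
     \<lparr>sp = subtopology (sp Y) (fixed_points (Lam_class G n \<sigma> \<one>\<^bsub>G\<^esub> ` carrier (Rn_group n)) Y),
      act = (\<lambda>g. act Y (Lam_class G n \<sigma> g (\<lambda>i. 0)))\<rparr>"


section \<open>The quasi-theory\<close>

definition QE_group :: "'g topgrp \<Rightarrow> 'g set \<Rightarrow> nat
    \<Rightarrow> (('g \<times> (nat \<Rightarrow> real)) set topgrp \<Rightarrow> (('g \<times> (nat \<Rightarrow> real)) set, 'x, 'e) cohomology)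
    \<Rightarrow> int \<Rightarrow> ('g, 'x) gspace \<Rightarrow> ((nat \<Rightarrow> 'g) \<Rightarrow> 'e) monoid" where
  "QE_group G R n E m X =
     product_group (Gnz G R n) (\<lambda>\<sigma>. grp (E (Lam G n \<sigma>)) m (fix_sigma n \<sigma> X, {}))"

definition QE_ind :: "'g topgrp \<Rightarrow> 'g set \<Rightarrow> nat
    \<Rightarrow> (('g \<times> (nat \<Rightarrow> real)) set topgrp \<Rightarrow> (('g \<times> (nat \<Rightarrow> real)) set, 'x, 'e) cohomology)
    \<Rightarrow> int \<Rightarrow> ('g, 'x) gspace \<Rightarrow> ('g, 'x) gspace \<Rightarrow> ('x \<Rightarrow> 'x)
    \<Rightarrow> ((nat \<Rightarrow> 'g) \<Rightarrow> 'e) \<Rightarrow> (nat \<Rightarrow> 'g) \<Rightarrow> 'e" where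
  "QE_ind G R n E m X X' f z =
     (\<lambda>\<sigma>\<in>Gnz G R n. ind (E (Lam G n \<sigma>)) m (fix_sigma n \<sigma> X, {}) (fix_sigma n \<sigma> X', {}) f (z \<sigma>))"

text \<open>Reduced value at a based G-space: the kernel of the restriction to the base point.\<close>

definition QE_reduced :: "'g topgrp \<Rightarrow> 'g set \<Rightarrow> nat
    \<Rightarrow> (('g \<times> (nat \<Rightarrow> real)) set topgrp \<Rightarrow> (('g \<times> (nat \<Rightarrow> real)) set, 'x, 'e) cohomology)
    \<Rightarrow> int \<Rightarrow> ('g, 'x) gspace \<Rightarrow> 'x \<Rightarrow> ((nat \<Rightarrow> 'g) \<Rightarrow> 'e) set" where
  "QE_reduced G R n E m X b =
     kernel (QE_group G R n E m X) (QE_group G R n E m (gsub X {b}))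
       (QE_ind G R n E m (gsub X {b}) X (\<lambda>x. x))"

definition S0 :: "'x \<Rightarrow> 'x \<Rightarrow> ('g, 'x) gspace" where
  "S0 b p = \<lparr>sp = discrete_topology {b, p}, act = (\<lambda>g x. x)\<rparr>"


section \<open>Joins\<close>

text \<open>A point of the join of the finite family \<open>F i\<close> (i in I) is a pair \<open>(t, x)\<close> of barycentric
  coordinates t and points \<open>x i\<close> of \<open>F i\<close> for those i with \<open>t i > 0\<close>. The topology is the quotient
  topology from the disjoint union, over nonempty subsets J of I, of the products of the simplex on
  J with the spaces \<open>F j\<close> (j in J). The subsets J are needed in order that empty factors can be
  omitted; the join of the empty family is empty.\<close>

definition simplex_top :: "'i set \<Rightarrow> ('i \<Rightarrow> real) topology" where
  "simplex_top J = subtopology (powertop_real UNIV)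
     {t. (\<forall>i. 0 \<le> t i) \<and> (\<forall>i. i \<notin> J \<longrightarrow> t i = 0) \<and> sum t J = 1}"

definition join_piece :: "('i \<Rightarrow> ('g, 'x) gspace) \<Rightarrow> 'i set \<Rightarrow> (('i \<Rightarrow> real) \<times> ('i \<Rightarrow> 'x)) topology" where
  "join_piece F J = prod_topology (simplex_top J) (product_topology (\<lambda>i. sp (F i)) J)"

definition join_pt :: "('i \<Rightarrow> real) \<times> ('i \<Rightarrow> 'x) \<Rightarrow> ('i \<Rightarrow> real) \<times> ('i \<Rightarrow> 'x)" where
  "join_pt = (\<lambda>(t, x). (t, restrict x {i. 0 < t i}))"

definition join_family_top :: "'i set \<Rightarrow> ('i \<Rightarrow> ('g, 'x) gspace) \<Rightarrow> (('i \<Rightarrow> real) \<times> ('i \<Rightarrow> 'x)) topology" where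
  "join_family_top I F = topology (\<lambda>U.
     U \<subseteq> (\<Union>J\<in>{J. J \<subseteq> I \<and> finite J \<and> J \<noteq> {}}. join_pt ` topspace (join_piece F J)) \<and>
     (\<forall>J\<in>{J. J \<subseteq> I \<and> finite J \<and> J \<noteq> {}}.
        openin (join_piece F J) {p \<in> topspace (join_piece F J). join_pt p \<in> U}))"

lemma openin_join_family_top:
  "openin (join_family_top I F) U \<longleftrightarrow>
     U \<subseteq> (\<Union>J\<in>{J. J \<subseteq> I \<and> finite J \<and> J \<noteq> {}}. join_pt ` topspace (join_piece F J)) \<and>
     (\<forall>J\<in>{J. J \<subseteq> I \<and> finite J \<and> J \<noteq> {}}.
        openin (join_piece F J) {p \<in> topspace (join_piece F J). join_pt p \<in> U})"
  unfolding join_family_top_def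
  by (subst topology_inverse')
    (intro istopology_conj istopology_subset istopology_all istopology_preimage, rule refl)

definition join_family :: "'i set \<Rightarrow> ('i \<Rightarrow> ('g, 'x) gspace) \<Rightarrow> ('g, ('i \<Rightarrow> real) \<times> ('i \<Rightarrow> 'x)) gspace" where
  "join_family I F =
     \<lparr>sp = join_family_top I F,
      act = (\<lambda>g (t, x). (t, \<lambda>i\<in>{i. 0 < t i}. act (F i) g (x i)))\<rparr>"

text \<open>The binary join, in the same style: \<open>(Some x, None, 0)\<close> is the point x of X,
  \<open>(None, Some y, 1)\<close> is the point y of Y, and \<open>(Some x, Some y, t)\<close> with \<open>0 < t < 1\<close> lies on the
  segment between them.\<close>

definition join2_pt :: "'x \<times> 'y \<times> real \<Rightarrow> 'x option \<times> 'y option \<times> real" where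
  "join2_pt = (\<lambda>(x, y, t). (if t = 1 then None else Some x, if t = 0 then None else Some y, t))"

abbreviation join2_left :: "'x \<Rightarrow> 'x option \<times> 'y option \<times> real" where
  "join2_left x \<equiv> (Some x, None, 0)"

abbreviation join2_right :: "'y \<Rightarrow> 'x option \<times> 'y option \<times> real" where
  "join2_right y \<equiv> (None, Some y, 1)"

definition join2_cyl :: "'x topology \<Rightarrow> 'y topology \<Rightarrow> ('x \<times> 'y \<times> real) topology" where
  "join2_cyl X Y = prod_topology X (prod_topology Y (top_of_set {0..1}))"

definition join2_top :: "'x topology \<Rightarrow> 'y topology \<Rightarrow> ('x option \<times> 'y option \<times> real) topology" where
  "join2_top X Y = topology (\<lambda>U.
     U \<subseteq> join2_left ` topspace X \<union> join2_right ` topspace Y \<union> join2_pt ` topspace (join2_cyl X Y) \<and>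
     openin X {x \<in> topspace X. join2_left x \<in> U} \<and>
     openin Y {y \<in> topspace Y. join2_right y \<in> U} \<and>
     openin (join2_cyl X Y) {p \<in> topspace (join2_cyl X Y). join2_pt p \<in> U})"

lemma openin_join2_top:
  "openin (join2_top X Y) U \<longleftrightarrow>
     U \<subseteq> join2_left ` topspace X \<union> join2_right ` topspace Y \<union> join2_pt ` topspace (join2_cyl X Y) \<and>
     openin X {x \<in> topspace X. join2_left x \<in> U} \<and>
     openin Y {y \<in> topspace Y. join2_right y \<in> U} \<and>
     openin (join2_cyl X Y) {p \<in> topspace (join2_cyl X Y). join2_pt p \<in> U}"
  unfolding join2_top_def
  by (subst topology_inverse')
    (intro istopology_conj istopology_subset istopology_preimage, rule refl)

definition join2 :: "('g, 'x) gspace \<Rightarrow> ('g, 'y) gspace \<Rightarrow> ('g, 'x option \<times> 'y option \<times> real) gspace" where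
  "join2 X Y =
     \<lparr>sp = join2_top (sp X) (sp Y),
      act = (\<lambda>g (a, b, t). (map_option (act X g) a, map_option (act Y g) b, t))\<rparr>"


section \<open>Coinduced spaces and the representing space\<close>

definition compact_open_topology :: "'a topology \<Rightarrow> 'b topology \<Rightarrow> ('a \<Rightarrow> 'b) set \<Rightarrow> ('a \<Rightarrow> 'b) topology" where
  "compact_open_topology X Y M =
     topology_generated_by {{f \<in> M. f ` C \<subseteq> U} |C U. compactin X C \<and> openin Y U}"

text \<open>\<open>Map_K(G, Y)\<close>. Maps are extensional, so that equality is equality on \<open>carrier G\<close>.\<close>

definition coind :: "'g topgrp \<Rightarrow> 'g set \<Rightarrow> ('g, 'y) gspace \<Rightarrow> ('g, 'g \<Rightarrow> 'y) gspace" where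
  "coind G K Y =
     \<lparr>sp = compact_open_topology (gtop G) (sp Y)
        {f \<in> extensional (carrier G). continuous_map (gtop G) (sp Y) f \<and>
           (\<forall>k\<in>K. \<forall>g\<in>carrier G. f (k \<otimes>\<^bsub>G\<^esub> g) = act Y k (f g))},
      act = (\<lambda>g f. \<lambda>x\<in>carrier G. f (x \<otimes>\<^bsub>G\<^esub> g))\<rparr>"

definition maximal_subgroups :: "'g topgrp \<Rightarrow> 'g set set" where
  "maximal_subgroups G = {K. subgroup K G \<and> K \<noteq> carrier G \<and>
     (\<forall>L. subgroup L G \<longrightarrow> K \<subseteq> L \<longrightarrow> L = K \<or> L = carrier G)}"

definition universal_space :: "'g topgrp \<Rightarrow> ('g, 'u) gspace \<Rightarrow> bool" where
  "universal_space G U \<longleftrightarrow> is_gspace G U \<and> topspace (sp U) \<noteq> {} \<and> contractible_space (sp U) \<and>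
     (\<forall>g\<in>carrier G. \<forall>x\<in>topspace (sp U). act U g x = x \<longrightarrow> g = \<one>\<^bsub>G\<^esub>)"

text \<open>A \<open>G/K\<close>-space regarded as a G-space.\<close>

definition inflate :: "'g topgrp \<Rightarrow> 'g set \<Rightarrow> ('g set, 'u) gspace \<Rightarrow> ('g, 'u) gspace" where
  "inflate G K U = \<lparr>sp = sp U, act = (\<lambda>g. act U (K #>\<^bsub>G\<^esub> g))\<rparr>"

text \<open>\<open>U K\<close> is the chosen universal space of the quotient of \<open>Gam G n \<sigma>\<close> by K.\<close>

definition S_space :: "'g topgrp \<Rightarrow> nat \<Rightarrow> (nat \<Rightarrow> 'g) \<Rightarrow> ('g set \<Rightarrow> ('g set, 'u) gspace)
    \<Rightarrow> ('g, 'g \<Rightarrow> ('g set \<Rightarrow> real) \<times> ('g set \<Rightarrow> 'u)) gspace" where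
  "S_space G n \<sigma> U =
     coind (centr G n \<sigma>) (carrier (Gam G n \<sigma>))
       (join_family (maximal_subgroups (Gam G n \<sigma>)) (\<lambda>K. inflate (Gam G n \<sigma>) K (U K)))"

definition R_space :: "'g topgrp \<Rightarrow> nat \<Rightarrow> (nat \<Rightarrow> 'g) \<Rightarrow> ('g set \<Rightarrow> ('g set, 'u) gspace)
    \<Rightarrow> (('g \<times> (nat \<Rightarrow> real)) set, 'y) gspace
    \<Rightarrow> ('g, 'g \<Rightarrow> 'y option \<times> ('g \<Rightarrow> ('g set \<Rightarrow> real) \<times> ('g set \<Rightarrow> 'u)) option \<times> real) gspace" where
  "R_space G n \<sigma> U Y =
     coind G (carrier (centr G n \<sigma>)) (join2 (fix_Rn G n \<sigma> Y) (S_space G n \<sigma> U))"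

definition gprod :: "'i set \<Rightarrow> ('i \<Rightarrow> ('g, 'x) gspace) \<Rightarrow> ('g, 'i \<Rightarrow> 'x) gspace" where
  "gprod I F = \<lparr>sp = product_topology (\<lambda>i. sp (F i)) I, act = (\<lambda>g f. \<lambda>i\<in>I. act (F i) g (f i))\<rparr>"

definition QE_space :: "'g topgrp \<Rightarrow> 'g set \<Rightarrow> nat
    \<Rightarrow> ((nat \<Rightarrow> 'g) \<Rightarrow> 'g set \<Rightarrow> ('g set, 'u) gspace)
    \<Rightarrow> ((nat \<Rightarrow> 'g) \<Rightarrow> (('g \<times> (nat \<Rightarrow> real)) set, 'y) gspace)
    \<Rightarrow> ('g, (nat \<Rightarrow> 'g) \<Rightarrow> 'g \<Rightarrow>
          'y option \<times> ('g \<Rightarrow> ('g set \<Rightarrow> real) \<times> ('g set \<Rightarrow> 'u)) option \<times> real) gspace" where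
  "QE_space G R n U Y = gprod (Gnz G R n) (\<lambda>\<sigma>. R_space G n \<sigma> (U \<sigma>) (Y \<sigma>))"

end

(* A G-fixed point of Map_C(G, Z) is a constant map at a C-fixed point of Z.  A Gamma-fixed point of
   the join of the E(Gamma/K) would have a Gamma-fixed coordinate in some E(Gamma/K), which is
   impossible because K is a proper subgroup; so S has no C-fixed points, and the C-fixed points of
   Y^{R^n} * S are those of Y^{R^n}, that is, Y^Lambda.  Thus the fixed points of the representing
   space are the product of the Y^Lambda over sigma.  On pi_0 this gives the product of the sets
   [pt, Y]^Lambda = E^m_Lambda(pt), and additivity identifies the latter product with the reduced
   value at S^0. *)

theory Submission
  imports Defs
begin

section \<open>Fixed points of products, coinduced spaces and joins\<close>

text \<open>The passage to \<open>pi_0\<close> depends on topologies and not only on point sets.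
  Mapping spaces carry the compact-open topology and joins a quotient topology, so the
  correspondence between \<open>Y^\<Lambda>\<close> and the fixed points of the representing space
  must be shown continuous both ways. The delicate direction leaves the join: its left end has to
  carry the original topology of the left factor. Once both maps are continuous, they carry paths to
  paths.

  The index set \<open>Gnz G R n\<close> may be infinite (for the circle group, say), so path
  components are compared in a product of arbitrary size, by choosing one path in every factor.

  For the tuple of units \<Gamma> is trivial and has no proper subgroup. The family to be joined is
  then empty, S is empty, and the join with it is \<open>Y^{R^n}\<close> alone; the general argument
  covers this because its condition on the family holds vacuously.\<close>

lemma fixed_points_gprod: "fixed_points S (gprod I F) = (\<Pi>\<^sub>E i\<in>I. fixed_points S (F i))"
proof (intro equalityI subsetI)
  fix f assume f: "f \<in> fixed_points S (gprod I F)"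
  then have top: "f \<in> (\<Pi>\<^sub>E i\<in>I. topspace (sp (F i)))"
    and act: "\<And>g. g \<in> S \<Longrightarrow> (\<lambda>i\<in>I. act (F i) g (f i)) = f"
    by (simp_all add: fixed_points_def gprod_def)
  have "f i \<in> fixed_points S (F i)" if "i \<in> I" for i
  proof -
    have "act (F i) g (f i) = f i" if "g \<in> S" for g
      using fun_cong[OF act[OF that], of i] \<open>i \<in> I\<close> by simp
    with PiE_mem[OF top that] show ?thesis
      by (simp add: fixed_points_def)
  qed
  with top show "f \<in> (\<Pi>\<^sub>E i\<in>I. fixed_points S (F i))"
    by (simp add: PiE_iff)
next
  fix f assume f: "f \<in> (\<Pi>\<^sub>E i\<in>I. fixed_points S (F i))"
  then have top: "f \<in> (\<Pi>\<^sub>E i\<in>I. topspace (sp (F i)))"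
    by (simp add: PiE_iff fixed_points_def)
  have "(\<lambda>i\<in>I. act (F i) g (f i)) i = f i" if "g \<in> S" for g i
  proof (cases "i \<in> I")
    case True
    with PiE_mem[OF f True] that show ?thesis by (simp add: fixed_points_def)
  next
    case False
    with PiE_arb[OF f False] show ?thesis by simp
  qed
  then have "(\<lambda>i\<in>I. act (F i) g (f i)) = f" if "g \<in> S" for g
    using that by blast
  with top show "f \<in> fixed_points S (gprod I F)"
    by (simp add: fixed_points_def gprod_def)
qed

section \<open>Coinduced spaces and the compact-open topology\<close>

lemma topspace_compact_open_topology: "topspace (compact_open_topology X Y M) = M"
proof -
  have "M \<in> {{f \<in> M. f ` C \<subseteq> U} |C U. compactin X C \<and> openin Y U}"
    \<comment> \<open>The empty compact set imposes no condition on \<open>f\<close>, so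
      \<open>M\<close> itself is a subbasic set.\<close>
    by (rule CollectI, rule exI[of _ "{}"], rule exI[of _ "{}"]) auto
  then show ?thesis
    unfolding compact_open_topology_def topology_generated_by_topspace by blast
qed

lemma fixed_points_coind:
  assumes "group G" and top: "topspace (gtop G) = carrier G" and K: "K \<subseteq> carrier G"
  shows "fixed_points (carrier G) (coind G K Z) = (\<lambda>z. \<lambda>x\<in>carrier G. z) ` fixed_points K Z"
proof (intro equalityI subsetI)
  interpret group G by fact
  fix f assume f: "f \<in> fixed_points (carrier G) (coind G K Z)"
  then have ext: "f \<in> extensional (carrier G)"
    and cont: "continuous_map (gtop G) (sp Z) f"
    and equ: "\<And>k g. k \<in> K \<Longrightarrow> g \<in> carrier G \<Longrightarrow> f (k \<otimes>\<^bsub>G\<^esub> g) = act Z k (f g)"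
    and fix_f: "\<And>g. g \<in> carrier G \<Longrightarrow> (\<lambda>x\<in>carrier G. f (x \<otimes>\<^bsub>G\<^esub> g)) = f"
    by (auto simp: fixed_points_def coind_def topspace_compact_open_topology)
  \<comment> \<open>Invariance under right translation by \<open>g\<close>, evaluated at the unit,
    gives constancy.\<close>
  have const: "f g = f \<one>\<^bsub>G\<^esub>" if "g \<in> carrier G" for g
    using fun_cong[OF fix_f[OF that], of "\<one>\<^bsub>G\<^esub>"] that by simp
  have "act Z k (f \<one>\<^bsub>G\<^esub>) = f \<one>\<^bsub>G\<^esub>" if "k \<in> K" for k
    using equ[OF that, of "\<one>\<^bsub>G\<^esub>"] const[of k] that K by auto
  moreover have "f \<one>\<^bsub>G\<^esub> \<in> topspace (sp Z)"
    using cont top by (auto simp: continuous_map_def)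
  ultimately have "f \<one>\<^bsub>G\<^esub> \<in> fixed_points K Z"
    by (simp add: fixed_points_def)
  moreover have "f = (\<lambda>x\<in>carrier G. f \<one>\<^bsub>G\<^esub>)"
  proof (rule extensionalityI[OF ext])
    show "f g = (\<lambda>x\<in>carrier G. f \<one>\<^bsub>G\<^esub>) g" if "g \<in> carrier G" for g
      using const[OF that] that by simp
  qed simp
  ultimately show "f \<in> (\<lambda>z. \<lambda>x\<in>carrier G. z) ` fixed_points K Z"
    by blast
next
  interpret group G by fact
  fix f assume "f \<in> (\<lambda>z. \<lambda>x\<in>carrier G. z) ` fixed_points K Z"
  then obtain z where z: "z \<in> fixed_points K Z" and f: "f = (\<lambda>x\<in>carrier G. z)"
    by blast
  have "continuous_map (gtop G) (sp Z) (\<lambda>x. z)"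
    using z by (simp add: fixed_points_def)
  then have "continuous_map (gtop G) (sp Z) f"
    unfolding f by (rule continuous_map_eq) (simp add: top)
  then show "f \<in> fixed_points (carrier G) (coind G K Z)"
    using z K by (auto simp: f fixed_points_def coind_def topspace_compact_open_topology
        intro!: restrict_ext)
qed

text \<open>A point is compact, so the preimage of an open set under evaluation at \<open>a\<close>
  is itself subbasic. Evaluation at the unit later recovers the value of a constant map.\<close>

lemma continuous_map_coind_eval:
  assumes "topspace (gtop G) = carrier G" "a \<in> carrier G"
  shows "continuous_map (sp (coind G K Z)) (sp Z) (\<lambda>f. f a)"
proof -
  let ?M = "{f \<in> extensional (carrier G). continuous_map (gtop G) (sp Z) f \<and>
           (\<forall>k\<in>K. \<forall>g\<in>carrier G. f (k \<otimes>\<^bsub>G\<^esub> g) = act Z k (f g))}"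
  have "openin (compact_open_topology (gtop G) (sp Z) ?M) {f \<in> ?M. f a \<in> V}"
    if "openin (sp Z) V" for V
  proof -
    have "{f \<in> ?M. f a \<in> V} = {f \<in> ?M. f ` {a} \<subseteq> V}" by auto
    moreover have "compactin (gtop G) {a}" using assms by simp
    ultimately show ?thesis
      unfolding compact_open_topology_def using that
      by (intro topology_generated_by_Basis) blast
  qed
  moreover have "f a \<in> topspace (sp Z)" if "f \<in> ?M" for f
    using that assms by (auto simp: continuous_map_def)
  ultimately show ?thesis
    by (auto simp: continuous_map_def coind_def topspace_compact_open_topology)
qed

text \<open>The inverse of evaluation on fixed points. A constant map sends \<open>C\<close> into
  \<open>V\<close> exactly when \<open>C\<close> is empty or its value lies in \<open>V\<close>, so
  a subbasic set pulls back either to everything or to the trace of \<open>V\<close>.\<close>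

lemma continuous_map_coind_const:
  assumes "group G" "topspace (gtop G) = carrier G" "K \<subseteq> carrier G"
  shows "continuous_map (subtopology (sp Z) (fixed_points K Z))
     (subtopology (sp (coind G K Z)) (fixed_points (carrier G) (coind G K Z)))
     (\<lambda>z. \<lambda>x\<in>carrier G. z)"
proof -
  let ?T = "subtopology (sp Z) (fixed_points K Z)"
  let ?c = "\<lambda>z. \<lambda>x\<in>carrier G. z"
  define M where "M = {f \<in> extensional (carrier G). continuous_map (gtop G) (sp Z) f \<and>
           (\<forall>k\<in>K. \<forall>g\<in>carrier G. f (k \<otimes>\<^bsub>G\<^esub> g) = act Z k (f g))}"
  let ?B = "{{f \<in> M. f ` C \<subseteq> V} |C V. compactin (gtop G) C \<and> openin (sp Z) V}"
  have sp_eq: "sp (coind G K Z) = topology_generated_by ?B"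
    by (simp add: coind_def compact_open_topology_def M_def)
  have top_eq: "topspace (sp (coind G K Z)) = M"
    by (simp add: coind_def topspace_compact_open_topology M_def)
  have topT: "topspace ?T = fixed_points K Z"
    by (auto simp: fixed_points_def)
  have mem: "?c z \<in> fixed_points (carrier G) (coind G K Z)" if "z \<in> fixed_points K Z" for z
    using that by (simp add: fixed_points_coind[OF assms])
  have M: "?c z \<in> M" if "z \<in> fixed_points K Z" for z
    using mem[OF that] by (simp add: fixed_points_def top_eq)
  have "continuous_map ?T (topology_generated_by ?B) ?c"
  proof (rule continuous_on_generated_topo)
    fix W assume "W \<in> ?B"
    then obtain C V where W: "W = {f \<in> M. f ` C \<subseteq> V}"
      and C: "compactin (gtop G) C" and V: "openin (sp Z) V"
      by blast
    have "C \<subseteq> carrier G"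
      using compactin_subset_topspace[OF C] assms(2) by simp
    then have "?c z ` C \<subseteq> V \<longleftrightarrow> C = {} \<or> z \<in> V" for z
      by (auto simp: image_subset_iff subset_iff)
    then have "?c -` W \<inter> topspace ?T = (if C = {} then topspace ?T else topspace ?T \<inter> V)"
      using M unfolding W topT by auto
    moreover have "openin ?T (topspace ?T \<inter> V)"
      using V by (metis openin_subtopology_Int2 topspace_subtopology Int_assoc Int_commute
          openin_Int openin_topspace)
    ultimately show "openin ?T (?c -` W \<inter> topspace ?T)"
      by (simp del: topspace_subtopology)
  next
    have "\<Union> ?B = M"
      using top_eq unfolding sp_eq topology_generated_by_topspace .
    then show "?c ` topspace ?T \<subseteq> \<Union> ?B"
      using M topT by (simp add: image_subset_iff del: topspace_subtopology)
  qed
  then show ?thesis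
    using mem by (auto simp: continuous_map_in_subtopology sp_eq)
qed

section \<open>The join of two spaces\<close>

lemma topspace_join2_top:
  "topspace (join2_top X Y) =
     join2_left ` topspace X \<union> join2_right ` topspace Y \<union> join2_pt ` topspace (join2_cyl X Y)"
    (is "_ = ?A")
proof -
  have "{x \<in> topspace X. join2_left x \<in> ?A} = topspace X"
    "{y \<in> topspace Y. join2_right y \<in> ?A} = topspace Y"
    "{q \<in> topspace (join2_cyl X Y). join2_pt q \<in> ?A} = topspace (join2_cyl X Y)"
    by auto
  then have "openin (join2_top X Y) ?A"
    unfolding openin_join2_top by simp
  moreover have "topspace (join2_top X Y) \<subseteq> ?A"
    using openin_topspace[of "join2_top X Y"] unfolding openin_join2_top by blast
  ultimately show ?thesis
    by (meson openin_subset subset_antisym)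
qed

text \<open>The action preserves the join parameter and moves the two coordinates separately. A
  right coordinate of a fixed point would therefore be fixed in \<open>Z\<close>, so only points of
  the left end remain.\<close>

lemma fixed_points_join2:
  assumes "fixed_points K Z = {}"
  shows "fixed_points K (join2 X Z) = join2_left ` fixed_points K X"
proof (intro equalityI)
  show "fixed_points K (join2 X Z) \<subseteq> join2_left ` fixed_points K X"
  proof
    fix w assume w: "w \<in> fixed_points K (join2 X Z)"
    then have top: "w \<in> topspace (join2_top (sp X) (sp Z))"
      and act: "\<And>k. k \<in> K \<Longrightarrow> act (join2 X Z) k w = w"
      by (auto simp: fixed_points_def join2_def)
    have no: "fst (snd w) = None"
    proof (rule ccontr)
      assume "fst (snd w) \<noteq> None"
      then obtain y where y: "fst (snd w) = Some y" by blast
      have "y \<in> topspace (sp Z)"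
        using top y by (auto simp: topspace_join2_top join2_cyl_def join2_pt_def split: if_splits)
      moreover have "act Z k y = y" if "k \<in> K" for k
        using act[OF that] y by (cases w) (auto simp: join2_def)
      ultimately have "y \<in> fixed_points K Z"
        by (simp add: fixed_points_def)
      with assms show False by simp
    qed
    then obtain x where x: "w = join2_left x" "x \<in> topspace (sp X)"
      using top by (auto simp: topspace_join2_top join2_cyl_def join2_pt_def split: if_splits)
    moreover have "act X k x = x" if "k \<in> K" for k
      using act[OF that] x by (auto simp: join2_def)
    ultimately show "w \<in> join2_left ` fixed_points K X"
      by (auto simp: fixed_points_def)
  qed
  show "join2_left ` fixed_points K X \<subseteq> fixed_points K (join2 X Z)"
    by (auto simp: fixed_points_def join2_def topspace_join2_top)
qed

text \<open>Openness of the trace on the left end is one of the conditions that define the open sets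
  of the join.\<close>

lemma continuous_map_join2_left: "continuous_map X (join2_top X Y) join2_left"
  unfolding continuous_map_def topspace_join2_top by (auto simp: openin_join2_top)

text \<open>An open set \<open>V\<close> of \<open>X\<close> extends to the open subset of the join lying over \<open>V\<close> in which
  the join parameter is less than 1.\<close>

lemma continuous_map_join2_left_inverse:
  "continuous_map (subtopology (join2_top X Y) (range join2_left)) X (\<lambda>w. the (fst w))"
  unfolding continuous_map_def
proof (intro conjI allI impI)
  show "(\<lambda>w. the (fst w)) \<in> topspace (subtopology (join2_top X Y) (range join2_left)) \<rightarrow> topspace X"
    by (auto simp: topspace_join2_top join2_pt_def join2_cyl_def split: if_splits)
  fix V assume V: "openin X V"
  let ?W = "join2_left ` V \<union> join2_pt ` (V \<times> topspace Y \<times> {0..<1})"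
  have VX: "V \<subseteq> topspace X" by (rule openin_subset[OF V])
  have 1: "{x \<in> topspace X. join2_left x \<in> ?W} = V"
    using VX by (auto simp: join2_pt_def split: if_splits)
  have 2: "{y \<in> topspace Y. join2_right y \<in> ?W} = {}"
    by (auto simp: join2_pt_def split: if_splits)
  have 3: "{q \<in> topspace (join2_cyl X Y). join2_pt q \<in> ?W} = V \<times> topspace Y \<times> {0..<1}"
    using VX by (auto simp: join2_cyl_def join2_pt_def image_iff split: if_splits) force+
  have "openin (top_of_set {0..1}) {0..<1::real}"
    unfolding openin_open by (rule exI[of _ "{..<1}"]) auto
  then have "openin (join2_cyl X Y) (V \<times> topspace Y \<times> {0..<1})"
    using V by (simp add: join2_cyl_def openin_prod_Times_iff)
  moreover have "?W \<subseteq> topspace (join2_top X Y)"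
    using VX by (fastforce simp: topspace_join2_top join2_cyl_def)
  ultimately have "openin (join2_top X Y) ?W"
    using V unfolding openin_join2_top topspace_join2_top 1 2 3 by simp
  moreover have "{w \<in> topspace (subtopology (join2_top X Y) (range join2_left)). the (fst w) \<in> V}
      = ?W \<inter> range join2_left"
    using VX by (auto simp: topspace_join2_top join2_pt_def join2_cyl_def image_iff split: if_splits)
  ultimately show "openin (subtopology (join2_top X Y) (range join2_left))
     {w \<in> topspace (subtopology (join2_top X Y) (range join2_left)). the (fst w) \<in> V}"
    by (auto simp: openin_subtopology)
qed

text \<open>The barycentric coordinates of a point sum to 1, so one of them is positive, and the
  point of \<open>F i\<close> recorded there is fixed along with the whole. For empty
  \<open>I\<close> the assumption is vacuous and the join is empty.\<close>

lemma fixed_points_join_family_empty: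
  assumes "\<And>i. i \<in> I \<Longrightarrow> fixed_points K (F i) = {}"
  shows "fixed_points K (join_family I F) = {}"
proof (rule equals0I)
  fix w assume w: "w \<in> fixed_points K (join_family I F)"
  then have "w \<in> topspace (join_family_top I F)"
    by (simp add: fixed_points_def join_family_def)
  then have "w \<in> (\<Union>J\<in>{J. J \<subseteq> I \<and> finite J \<and> J \<noteq> {}}. join_pt ` topspace (join_piece F J))"
    using openin_topspace[of "join_family_top I F"] unfolding openin_join_family_top by blast
  then obtain J q where J: "J \<subseteq> I" and q: "q \<in> topspace (join_piece F J)" and wq: "w = join_pt q"
    by blast
  obtain t x where tx: "q = (t, x)" by (cases q)
  have t: "\<And>i. 0 \<le> t i" "sum t J = 1" and x: "x \<in> (\<Pi>\<^sub>E i\<in>J. topspace (sp (F i)))"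
    using q by (simp_all add: tx join_piece_def simplex_top_def)
  have w_eq: "w = (t, restrict x {i. 0 < t i})"
    by (simp add: wq tx join_pt_def)
  have "\<exists>i\<in>J. t i \<noteq> 0"
    using t(2) by (metis sum.neutral zero_neq_one)
  then obtain i where i: "i \<in> J" "0 < t i"
    using t(1) by (metis order_le_less)
  have "act (F i) k (x i) = x i" if "k \<in> K" for k
  proof -
    have "(\<lambda>i\<in>{i. 0 < t i}. act (F i) k (restrict x {i. 0 < t i} i)) = restrict x {i. 0 < t i}"
      using w that by (simp add: fixed_points_def join_family_def w_eq)
    from fun_cong[OF this, of i] i(2) show ?thesis by simp
  qed
  with x i have "x i \<in> fixed_points K (F i)"
    by (auto simp: fixed_points_def)
  with assms J i show False by auto
qed

section \<open>Path components\<close>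

lemma path_component_of_continuous_map:
  assumes "continuous_map X Y f" "path_component_of X x y"
  shows "path_component_of Y (f x) (f y)"
  using assms by (metis comp_apply path_component_of_def pathin_compose)

text \<open>A path in a product is an arbitrary family of paths, one in each factor, whatever the
  size of \<open>I\<close>. Extensionality of \<open>f\<close> and \<open>g\<close> makes the
  endpoints of the assembled path agree with them outside \<open>I\<close> as well.\<close>

lemma path_component_of_product_topology:
  assumes "f \<in> extensional I" "g \<in> extensional I"
  shows "path_component_of (product_topology X I) f g \<longleftrightarrow> (\<forall>i\<in>I. path_component_of (X i) (f i) (g i))"
proof
  assume *: "path_component_of (product_topology X I) f g"
  show "\<forall>i\<in>I. path_component_of (X i) (f i) (g i)"
  proof
    fix i assume "i \<in> I"
    from path_component_of_continuous_map[OF continuous_map_product_projection[OF this] *]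
    show "path_component_of (X i) (f i) (g i)" .
  qed
next
  assume "\<forall>i\<in>I. path_component_of (X i) (f i) (g i)"
  then obtain h where h: "\<And>i. i \<in> I \<Longrightarrow> pathin (X i) (h i) \<and> h i 0 = f i \<and> h i 1 = g i"
    unfolding path_component_of_def by metis
  let ?h = "\<lambda>t. \<lambda>i\<in>I. h i t"
  have "pathin (product_topology X I) ?h"
    using h by (simp add: pathin_def continuous_map_componentwise image_subset_iff)
  moreover have "?h 0 = f"
    by (rule extensionalityI[of _ I]) (simp_all add: h assms)
  moreover have "?h 1 = g"
    by (rule extensionalityI[of _ I]) (simp_all add: h assms)
  ultimately show "path_component_of (product_topology X I) f g"
    unfolding path_component_of_def by blast
qed

section \<open>The groups attached to a commuting tuple\<close>

text \<open>The record types of topological groups differ from those of the algebraic direct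
  products and quotients; this transfers the group axioms between records with the same three
  algebraic fields.\<close>

lemma group_cong:
  assumes "group M" "carrier N = carrier M" "mult N = mult M" "one N = one M"
  shows "group N"
proof -
  interpret M: group M by fact
  show ?thesis
    by (rule groupI) (auto simp: assms(2-4) M.m_assoc intro: M.l_inv_ex)
qed

lemma group_sub_topgrp:
  assumes "group G" "subgroup S G"
  shows "group (sub_topgrp G S)"
  by (rule group_cong[OF subgroup.subgroup_is_group[OF assms(2,1)]]) (simp_all add: sub_topgrp_def)

lemma group_Rn_group: "group (Rn_group n)"
proof (rule groupI)
  fix x assume "x \<in> carrier (Rn_group n)"
  then show "\<exists>y\<in>carrier (Rn_group n). y \<otimes>\<^bsub>Rn_group n\<^esub> x = \<one>\<^bsub>Rn_group n\<^esub>"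
    by (intro bexI[of _ "\<lambda>i. - x i"]) (auto simp: Rn_group_def topspace_Euclidean_space)
qed (auto simp: Rn_group_def topspace_Euclidean_space add.assoc)

locale commuting_tuple = group G for G :: "'a topgrp" (structure) +
  fixes n :: nat and \<sigma> :: "nat \<Rightarrow> 'a"
  assumes top: "topspace (gtop G) = carrier G"
    and in_carrier: "i < n \<Longrightarrow> \<sigma> i \<in> carrier G"
    and commute: "i < n \<Longrightarrow> j < n \<Longrightarrow> \<sigma> i \<otimes> \<sigma> j = \<sigma> j \<otimes> \<sigma> i"
begin

lemma centr_simps:
  "carrier (centr G n \<sigma>) = {g \<in> carrier G. \<forall>i<n. g \<otimes> \<sigma> i = \<sigma> i \<otimes> g}"
  "mult (centr G n \<sigma>) = mult G" "one (centr G n \<sigma>) = \<one>"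
  "gtop (centr G n \<sigma>) = subtopology (gtop G) (carrier (centr G n \<sigma>))"
  by (simp_all add: centr_def sub_topgrp_def)

lemma carrier_centr_subset: "carrier (centr G n \<sigma>) \<subseteq> carrier G"
  by (auto simp: centr_simps)

lemma topspace_centr: "topspace (gtop (centr G n \<sigma>)) = carrier (centr G n \<sigma>)"
  using carrier_centr_subset by (auto simp: centr_simps(4) top)

lemma subgroup_centr: "subgroup (carrier (centr G n \<sigma>)) G"
proof (rule subgroupI)
  show "carrier (centr G n \<sigma>) \<noteq> {}"
    using in_carrier by (auto simp: centr_simps intro!: exI[of _ \<one>])
next
  fix a b assume ab: "a \<in> carrier (centr G n \<sigma>)" "b \<in> carrier (centr G n \<sigma>)"
  have "a \<otimes> b \<otimes> \<sigma> i = \<sigma> i \<otimes> (a \<otimes> b)" if "i < n" for i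
  proof -
    have "a \<otimes> b \<otimes> \<sigma> i = a \<otimes> (\<sigma> i \<otimes> b)"
      using ab that in_carrier[OF that] by (simp add: centr_simps m_assoc)
    also have "\<dots> = \<sigma> i \<otimes> (a \<otimes> b)"
      using ab that in_carrier[OF that] by (simp add: centr_simps flip: m_assoc)
    finally show ?thesis .
  qed
  with ab show "a \<otimes> b \<in> carrier (centr G n \<sigma>)"
    by (simp add: centr_simps)
next
  fix a assume a: "a \<in> carrier (centr G n \<sigma>)"
  have "inv a \<otimes> \<sigma> i = \<sigma> i \<otimes> inv a" if "i < n" for i
  proof -
    have "\<sigma> i = inv a \<otimes> (\<sigma> i \<otimes> a)"
      using a that in_carrier[OF that] by (simp add: centr_simps inv_solve_left)
    then show ?thesis
      using a that in_carrier[OF that] by (simp add: centr_simps inv_solve_right m_assoc)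
  qed
  with a show "inv a \<in> carrier (centr G n \<sigma>)"
    by (simp add: centr_simps)
qed (rule carrier_centr_subset)

lemma group_centr: "group (centr G n \<sigma>)"
  using group_sub_topgrp[OF group_axioms subgroup_centr] by (simp add: centr_def sub_topgrp_def)

lemma sigma_in_centr: "i < n \<Longrightarrow> \<sigma> i \<in> carrier (centr G n \<sigma>)"
  using in_carrier commute by (simp add: centr_simps)

text \<open>Since the \<sigma> i commute with each other, all generators of \<Gamma> lie in the
  centralizer. This is what allows coinduction from \<Gamma> to it.\<close>

lemma carrier_Gam_subset: "carrier (Gam G n \<sigma>) \<subseteq> carrier (centr G n \<sigma>)"
  using generate_subgroup_incl[OF _ subgroup_centr, of "\<sigma> ` {..<n}"] sigma_in_centr
  by (auto simp: Gam_def sub_topgrp_def)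

section \<open>The quotient group \<Lambda> and its fixed points\<close>

lemma Lam_cover_simps:
  "carrier (Lam_cover G n \<sigma>) = carrier (centr G n \<sigma>) \<times> carrier (Rn_group n)"
  "(g, s) \<otimes>\<^bsub>Lam_cover G n \<sigma>\<^esub> (h, t) = (g \<otimes> h, s \<otimes>\<^bsub>Rn_group n\<^esub> t)"
  by (simp_all add: Lam_cover_def prod_topgrp_def DirProd_def centr_simps)

lemma group_Lam_cover: "group (Lam_cover G n \<sigma>)"
  by (rule group_cong[OF DirProd_group[OF group_centr group_Rn_group]])
    (simp_all add: Lam_cover_def prod_topgrp_def)

text \<open>Each generator is central in the cover: \<sigma> i commutes with its own centralizer by
  definition, and the other factor is abelian. Conjugation thus fixes every generator.\<close>

lemma normal_Lam_ker: "Lam_ker G n \<sigma> \<lhd> Lam_cover G n \<sigma>"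
proof -
  interpret L: group "Lam_cover G n \<sigma>" by (rule group_Lam_cover)
  let ?H = "{(\<sigma> i, \<lambda>j. if j = i then - 1 else 0) |i. i < n} :: ('a \<times> (nat \<Rightarrow> real)) set"
  have H: "?H \<subseteq> carrier (Lam_cover G n \<sigma>)"
    using sigma_in_centr by (auto simp: Lam_cover_simps Rn_group_def topspace_Euclidean_space)
  have "g \<otimes>\<^bsub>Lam_cover G n \<sigma>\<^esub> h \<otimes>\<^bsub>Lam_cover G n \<sigma>\<^esub> inv\<^bsub>Lam_cover G n \<sigma>\<^esub> g = h"
    if h: "h \<in> ?H" and g: "g \<in> carrier (Lam_cover G n \<sigma>)" for g h
  proof -
    have "g \<otimes>\<^bsub>Lam_cover G n \<sigma>\<^esub> h = h \<otimes>\<^bsub>Lam_cover G n \<sigma>\<^esub> g"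
      using h g by (auto simp: Lam_cover_simps centr_simps Rn_group_def add.commute)
    moreover have "h \<in> carrier (Lam_cover G n \<sigma>)"
      using h H by blast
    ultimately show ?thesis
      using g by (simp add: L.m_assoc)
  qed
  then show ?thesis
    unfolding Lam_ker_def by (intro L.normal_generateI H) auto
qed

lemma Lam_simps:
  "carrier (Lam G n \<sigma>) = (\<lambda>(g, t). Lam_class G n \<sigma> g t) ` (carrier (centr G n \<sigma>) \<times> carrier (Rn_group n))"
  "gtop (Lam G n \<sigma>) = quotient_topology (gtop (Lam_cover G n \<sigma>))
     (\<lambda>c. Lam_ker G n \<sigma> #>\<^bsub>Lam_cover G n \<sigma>\<^esub> c)"
  by (auto simp: Lam_def quotient_topgrp_def FactGroup_def RCOSETS_def Lam_cover_simps Lam_class_def)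

lemma Lam_class_mult:
  assumes "g \<in> carrier (centr G n \<sigma>)" "h \<in> carrier (centr G n \<sigma>)"
    "s \<in> carrier (Rn_group n)" "t \<in> carrier (Rn_group n)"
  shows "Lam_class G n \<sigma> g s \<otimes>\<^bsub>Lam G n \<sigma>\<^esub> Lam_class G n \<sigma> h t =
    Lam_class G n \<sigma> (g \<otimes> h) (s \<otimes>\<^bsub>Rn_group n\<^esub> t)"
  using normal.rcos_sum[OF normal_Lam_ker, of "(g, s)" "(h, t)"] assms
  by (simp add: Lam_def quotient_topgrp_def FactGroup_def Lam_class_def Lam_cover_simps)

lemma group_Lam: "group (Lam G n \<sigma>)"
  by (rule group_cong[OF normal.factorgroup_is_group[OF normal_Lam_ker]])
    (simp_all add: Lam_def quotient_topgrp_def)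

text \<open>Used to view points as equivariant cells of type \<Lambda>/\<Lambda>, whose stabilizer,
  the whole group, has to be closed.\<close>

lemma topspace_Lam: "topspace (gtop (Lam G n \<sigma>)) = carrier (Lam G n \<sigma>)"
proof -
  have *: "topspace (quotient_topology X q) = q ` topspace X" for X :: "'c topology" and q :: "'c \<Rightarrow> 'd"
  proof
    have "{x \<in> topspace X. q x \<in> q ` topspace X} = topspace X" by auto
    then have "openin (quotient_topology X q) (q ` topspace X)"
      by (simp add: openin_quotient_topology)
    then show "q ` topspace X \<subseteq> topspace (quotient_topology X q)"
      by (rule openin_subset)
    show "topspace (quotient_topology X q) \<subseteq> q ` topspace X"
      using openin_topspace[of "quotient_topology X q"] unfolding openin_quotient_topology by blast
  qed
  have "topspace (gtop (Lam_cover G n \<sigma>)) = carrier (Lam_cover G n \<sigma>)"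
    by (simp add: Lam_cover_simps) (simp add: Lam_cover_def prod_topgrp_def topspace_centr Rn_group_def)
  then show ?thesis
    by (auto simp: Lam_simps * Lam_cover_simps Lam_class_def)
qed

text \<open>Every class factors as \<open>[g, t] = [g, 0] [1, t]\<close>, so being fixed by
  \<Lambda> amounts to being fixed by the classes \<open>[1, t]\<close> and then by the classes
  \<open>[g, 0]\<close>, through which the centralizer acts.\<close>

lemma fixed_points_Lam:
  assumes Y: "is_gspace (Lam G n \<sigma>) Y"
  shows "fixed_points (carrier (centr G n \<sigma>)) (fix_Rn G n \<sigma> Y) = fixed_points (carrier (Lam G n \<sigma>)) Y"
    (is "?A = ?B")
proof
  have zero: "(\<lambda>i. 0) \<in> carrier (Rn_group n)"
    by (simp add: Rn_group_def topspace_Euclidean_space)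
  have one: "\<one> \<in> carrier (centr G n \<sigma>)"
    using group.is_monoid[OF group_centr] by (metis monoid.one_closed centr_simps(3))
  show "?B \<subseteq> ?A"
    using zero one by (auto simp: fixed_points_def fix_Rn_def Lam_simps)
  show "?A \<subseteq> ?B"
  proof
    fix y assume "y \<in> ?A"
    then have y: "y \<in> topspace (sp Y)"
      and R: "\<And>t. t \<in> carrier (Rn_group n) \<Longrightarrow> act Y (Lam_class G n \<sigma> \<one> t) y = y"
      and C: "\<And>g. g \<in> carrier (centr G n \<sigma>) \<Longrightarrow> act Y (Lam_class G n \<sigma> g (\<lambda>i. 0)) y = y"
      by (auto simp: fixed_points_def fix_Rn_def)
    have "act Y (Lam_class G n \<sigma> g t) y = y"
      if gt: "g \<in> carrier (centr G n \<sigma>)" "t \<in> carrier (Rn_group n)" for g t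
    proof -
      have mem: "Lam_class G n \<sigma> g (\<lambda>i. 0) \<in> carrier (Lam G n \<sigma>)"
        "Lam_class G n \<sigma> \<one> t \<in> carrier (Lam G n \<sigma>)"
        using gt zero one by (auto simp: Lam_simps)
      have "g \<in> carrier G" using gt carrier_centr_subset by blast
      then have "Lam_class G n \<sigma> g t
          = Lam_class G n \<sigma> g (\<lambda>i. 0) \<otimes>\<^bsub>Lam G n \<sigma>\<^esub> Lam_class G n \<sigma> \<one> t"
        using gt zero one by (simp add: Lam_class_mult) (simp add: Rn_group_def)
      then have "act Y (Lam_class G n \<sigma> g t) y
          = act Y (Lam_class G n \<sigma> g (\<lambda>i. 0)) (act Y (Lam_class G n \<sigma> \<one> t) y)"
        using Y y mem by (auto simp: is_gspace_def)
      then show ?thesis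
        using R C gt by simp
    qed
    with y show "y \<in> ?B"
      by (auto simp: fixed_points_def Lam_simps)
  qed
qed

text \<open>A map fixed by the centralizer is constant with a \<Gamma>-fixed value, which moves the
  question from the centralizer to \<Gamma>.\<close>

lemma fixed_points_S_space:
  assumes U: "\<And>K. K \<in> maximal_subgroups (Gam G n \<sigma>) \<Longrightarrow>
     universal_space (quotient_topgrp (Gam G n \<sigma>) K) (U K)"
  shows "fixed_points (carrier (centr G n \<sigma>)) (S_space G n \<sigma> U) = {}"
proof -
  let ?\<Gamma> = "Gam G n \<sigma>"
  have "fixed_points (carrier ?\<Gamma>) (inflate ?\<Gamma> K (U K)) = {}"
    if K: "K \<in> maximal_subgroups ?\<Gamma>" for K
  proof (rule equals0I)
    fix x assume "x \<in> fixed_points (carrier ?\<Gamma>) (inflate ?\<Gamma> K (U K))"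
    then have x: "x \<in> topspace (sp (U K))"
      and act: "\<And>g. g \<in> carrier ?\<Gamma> \<Longrightarrow> act (U K) (K #>\<^bsub>?\<Gamma>\<^esub> g) x = x"
      by (simp_all add: fixed_points_def inflate_def)
    have sub: "subgroup K ?\<Gamma>" and ne: "K \<noteq> carrier ?\<Gamma>"
      using K by (simp_all add: maximal_subgroups_def)
    have grp: "group ?\<Gamma>"
      using in_carrier unfolding Gam_def
      by (intro group_sub_topgrp group_axioms generate_is_subgroup) auto
    \<comment> \<open>Freeness of the quotient action: the coset of \<open>g\<close> fixes
      \<open>x\<close>, hence is the unit coset \<open>K\<close>. As this holds for every
      \<open>g\<close>, \<open>K\<close> would be all of \<Gamma>.\<close>
    have "g \<in> K" if g: "g \<in> carrier ?\<Gamma>" for g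
    proof -
      have "K #>\<^bsub>?\<Gamma>\<^esub> g \<in> carrier (quotient_topgrp ?\<Gamma> K)"
        using g by (auto simp: quotient_topgrp_def FactGroup_def RCOSETS_def)
      with U[OF K] x act[OF g] have "K #>\<^bsub>?\<Gamma>\<^esub> g = K"
        by (auto simp: universal_space_def quotient_topgrp_def FactGroup_def)
      moreover have "g \<in> K #>\<^bsub>?\<Gamma>\<^esub> g"
        by (rule group.rcos_self[OF grp g sub])
      ultimately show ?thesis by simp
    qed
    with ne subgroup.subset[OF sub] show False by blast
  qed
  then show ?thesis
    unfolding S_space_def
    by (simp add: fixed_points_coind[OF group_centr topspace_centr carrier_Gam_subset]
        fixed_points_join_family_empty)
qed

section \<open>Fixed points and path components of a single factor\<close>

context
  fixes U :: "'a set \<Rightarrow> ('a set, 'u) gspace" and Y :: "(('a \<times> (nat \<Rightarrow> real)) set, 'y) gspace"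
  assumes U: "\<And>K. K \<in> maximal_subgroups (Gam G n \<sigma>) \<Longrightarrow>
     universal_space (quotient_topgrp (Gam G n \<sigma>) K) (U K)"
    and Y: "is_gspace (Lam G n \<sigma>) Y"
begin

lemma fixed_points_join:
  "fixed_points (carrier (centr G n \<sigma>)) (join2 (fix_Rn G n \<sigma> Y) (S_space G n \<sigma> U)) =
     join2_left ` fixed_points (carrier (Lam G n \<sigma>)) Y"
  by (simp add: fixed_points_join2[OF fixed_points_S_space[OF U]] fixed_points_Lam[OF Y])

lemma fixed_points_R_space:
  "fixed_points (carrier G) (R_space G n \<sigma> U Y) =
     (\<lambda>y. \<lambda>x\<in>carrier G. join2_left y) ` fixed_points (carrier (Lam G n \<sigma>)) Y"
  unfolding R_space_def fixed_points_coind[OF group_axioms top carrier_centr_subset]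
    fixed_points_join by (simp add: image_image)

text \<open>Paths travel from \<open>Y\<close> into the left end of the join and on to constant
  maps, and return by evaluation at the unit followed by the left coordinate. All four maps are
  continuous between the respective fixed-point spaces.\<close>

lemma path_component_of_R_space:
  assumes y: "y \<in> fixed_points (carrier (Lam G n \<sigma>)) Y" "y' \<in> fixed_points (carrier (Lam G n \<sigma>)) Y"
  shows "path_component_of
      (subtopology (sp (R_space G n \<sigma> U Y)) (fixed_points (carrier G) (R_space G n \<sigma> U Y)))
      (\<lambda>x\<in>carrier G. join2_left y) (\<lambda>x\<in>carrier G. join2_left y') \<longleftrightarrow>
    path_component_of (subtopology (sp Y) (fixed_points (carrier (Lam G n \<sigma>)) Y)) y y'"
    (is "path_component_of ?R (?c (join2_left y)) (?c (join2_left y')) \<longleftrightarrow> path_component_of ?F y y'")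
proof -
  let ?J = "join2 (fix_Rn G n \<sigma> Y) (S_space G n \<sigma> U)"
  let ?JC = "subtopology (sp ?J) (fixed_points (carrier (centr G n \<sigma>)) ?J)"
  \<comment> \<open>The \<Lambda>-fixed points lie inside those of \<open>\<real>\<^sup>n\<close>,
    so their topology is the same whether induced from \<open>fix_Rn\<close> or from
    \<open>Y\<close> directly.\<close>
  have F_eq: "subtopology (sp (fix_Rn G n \<sigma> Y)) (fixed_points (carrier (Lam G n \<sigma>)) Y) = ?F"
  proof -
    have "fixed_points (carrier (Lam G n \<sigma>)) Y
        \<subseteq> fixed_points (Lam_class G n \<sigma> \<one> ` carrier (Rn_group n)) Y"
    proof
      fix z assume "z \<in> fixed_points (carrier (Lam G n \<sigma>)) Y"
      then have "z \<in> topspace (sp (fix_Rn G n \<sigma> Y))"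
        unfolding fixed_points_Lam[OF Y, symmetric] by (simp add: fixed_points_def)
      then show "z \<in> fixed_points (Lam_class G n \<sigma> \<one> ` carrier (Rn_group n)) Y"
        by (simp add: fix_Rn_def)
    qed
    then show ?thesis
      by (simp add: fix_Rn_def subtopology_subtopology Int_absorb1)
  qed
  have "path_component_of ?R (?c (join2_left y)) (?c (join2_left y'))"
    if *: "path_component_of ?F y y'"
  proof -
    have "continuous_map ?F ?JC join2_left"
      unfolding fixed_points_join F_eq[symmetric]
      by (auto simp: continuous_map_in_subtopology join2_def
          intro!: continuous_map_from_subtopology continuous_map_join2_left)
    from path_component_of_continuous_map[OF this *]
    have J: "path_component_of ?JC (join2_left y) (join2_left y')" .
    have "continuous_map ?JC ?R ?c"
      using continuous_map_coind_const[OF group_axioms top carrier_centr_subset]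
      unfolding R_space_def .
    from path_component_of_continuous_map[OF this J] show ?thesis .
  qed
  moreover have "path_component_of ?F y y'"
    if *: "path_component_of ?R (?c (join2_left y)) (?c (join2_left y'))"
  proof -
    have "continuous_map ?R (sp ?J) (\<lambda>f. f \<one>)"
      unfolding R_space_def
      by (intro continuous_map_from_subtopology continuous_map_coind_eval top one_closed)
    moreover have "f \<one> \<in> join2_left ` fixed_points (carrier (Lam G n \<sigma>)) Y"
      if "f \<in> topspace ?R" for f
      using that by (auto simp: fixed_points_R_space)
    ultimately have "continuous_map ?R ?JC (\<lambda>f. f \<one>)"
      unfolding fixed_points_join continuous_map_in_subtopology by blast
    from path_component_of_continuous_map[OF this *]
    have J: "path_component_of ?JC (join2_left y) (join2_left y')"
      by simp
    have "continuous_map ?JC ?F (\<lambda>w. the (fst w))"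
    proof -
      \<comment> \<open>Passing through \<open>range join2_left\<close> makes the continuity of the
        left coordinate on the left end applicable.\<close>
      have "?JC = subtopology (subtopology (sp ?J) (range join2_left)) (join2_left ` fixed_points (carrier (Lam G n \<sigma>)) Y)"
        unfolding fixed_points_join subtopology_subtopology by (rule arg_cong[where f = "subtopology _"]) blast
      then have "continuous_map ?JC (sp (fix_Rn G n \<sigma> Y)) (\<lambda>w. the (fst w))"
        by (simp add: join2_def continuous_map_from_subtopology continuous_map_join2_left_inverse)
      moreover have "the (fst w) \<in> fixed_points (carrier (Lam G n \<sigma>)) Y" if "w \<in> topspace ?JC" for w
        using that unfolding fixed_points_join by auto
      ultimately show ?thesis
        unfolding F_eq[symmetric] continuous_map_in_subtopology by blast
    qed
    from path_component_of_continuous_map[OF this J] show ?thesis by simp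
  qed
  ultimately show ?thesis by blast
qed

end

end

section \<open>Discrete spaces with trivial action\<close>

text \<open>Both \<open>S0\<close> and its one-point subspaces have this form, and so do their
  images under \<open>gsub\<close> and \<open>fix_sigma\<close>. The acting group is left open
  because \<open>fix_sigma\<close> replaces G by \<Lambda>.\<close>

definition trivial_gspace :: "'x set \<Rightarrow> ('g, 'x) gspace" where
  "trivial_gspace A = \<lparr>sp = discrete_topology A, act = (\<lambda>g x. x)\<rparr>"

lemma S0_eq_trivial_gspace: "S0 b p = trivial_gspace {b, p}"
  by (simp add: S0_def trivial_gspace_def)

lemma gsub_trivial_gspace: "gsub (trivial_gspace A) B = trivial_gspace (A \<inter> B)"
  by (simp add: gsub_def trivial_gspace_def)

lemma fix_sigma_trivial_gspace: "fix_sigma n \<sigma> (trivial_gspace A) = trivial_gspace A"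
  by (simp add: fix_sigma_def trivial_gspace_def fixed_points_def)

text \<open>Every point is its own 0-cell of type H/H; a single coset and a single point of the
  0-disc make the constant characteristic map bijective onto it.\<close>

definition trivial_cells :: "'g topgrp \<Rightarrow> 'x set \<Rightarrow> ('g, 'x) gcells" where
  "trivial_cells H A =
     \<lparr>cells = (\<lambda>k. if k = 0 then A else {}), stab = (\<lambda>k j. carrier H), chr = (\<lambda>k j p. j)\<rparr>"

context
  fixes H :: "'g topgrp"
  assumes H: "group H" and top_H: "topspace (gtop H) = carrier H"
begin

lemma left_cosets_carrier: "left_cosets H (carrier H) = {carrier H}"
proof -
  interpret group H by (rule H)
  have "g <#\<^bsub>H\<^esub> carrier H = carrier H" if "g \<in> carrier H" for g
    using coset_join3[OF that subgroup_self that] .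
  then show ?thesis
    unfolding left_cosets_def using one_closed by blast
qed

lemma open_disc_0: "open_disc 0 = {\<lambda>i. 0}"
  by (auto simp: open_disc_def topspace_Euclidean_space)

lemma open_cell_trivial_cells: "open_cell H (trivial_cells H A) 0 j = {j}"
  by (simp add: open_cell_def trivial_cells_def left_cosets_carrier open_disc_0)

lemma is_gcw_trivial_gspace: "is_gcw H (trivial_gspace A) (trivial_cells H A)"
proof -
  interpret group H by (rule H)
  have gsp: "is_gspace H (trivial_gspace A :: ('g, 'x) gspace)" for A :: "'x set"
  proof -
    have "(\<lambda>(g, x). x) = (snd :: 'g \<times> 'x \<Rightarrow> 'x)" by auto
    then show ?thesis
      by (simp add: is_gspace_def trivial_gspace_def continuous_map_snd)
  qed
  have "closedin (gtop H) (carrier H)"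
    using closedin_topspace[of "gtop H"] by (simp add: top_H)
  moreover have "boundary_sphere 0 = {}"
    by (simp add: boundary_sphere_def)
  moreover have "bij_betw (\<lambda>(k, j, p). chr (trivial_cells H A) k j p)
      (SIGMA k:UNIV. SIGMA j:cells (trivial_cells H A) k.
         left_cosets H (stab (trivial_cells H A) k j) \<times> open_disc k) A"
  proof -
    have "(SIGMA k:UNIV. SIGMA j:cells (trivial_cells H A) k.
         left_cosets H (stab (trivial_cells H A) k j) \<times> open_disc k)
       = (\<lambda>j. (0, j, carrier H, \<lambda>i. 0)) ` A"
      by (auto simp: trivial_cells_def left_cosets_carrier open_disc_0 split: if_splits)
    then show ?thesis
      by (auto simp: bij_betw_def inj_on_def trivial_cells_def image_image)
  qed
  ultimately show ?thesis
    using gsp[of A] subgroup_self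
    unfolding is_gcw_def by (simp add: trivial_cells_def) (simp add: trivial_gspace_def)
qed

lemma subcomplex_trivial_gspace:
  "B \<subseteq> A \<Longrightarrow> subcomplex H (trivial_gspace A) (trivial_cells H A) B"
  using open_cell_trivial_cells[of A]
  by (auto simp: subcomplex_def trivial_gspace_def) (auto simp: trivial_cells_def split: if_splits)

lemma gcw_complex_trivial_gspace: "gcw_complex H (trivial_gspace A)"
  unfolding gcw_complex_def using is_gcw_trivial_gspace by blast

lemma gcw_pair_trivial_gspace: "gcw_pair H (trivial_gspace A, {})"
  unfolding gcw_pair_def using is_gcw_trivial_gspace subcomplex_trivial_gspace by fastforce

text \<open>Additivity over the two points turns a class on \<open>{b, p}\<close> into a pair of
  classes, one at each point. The kernel of restriction to \<open>b\<close> consists of the pairs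
  with unit entry at \<open>b\<close>, and these correspond to arbitrary entries at
  \<open>p\<close>.\<close>

lemma bij_betw_reduced_S0:
  assumes E: "equivariant_cohomology_theory H E" and "b \<noteq> p"
  shows "bij_betw (ind E m (trivial_gspace {p}, {}) (trivial_gspace {b, p}, {}) (\<lambda>x. x))
     {z \<in> carrier (grp E m (trivial_gspace {b, p}, {})).
        ind E m (trivial_gspace {b}, {}) (trivial_gspace {b, p}, {}) (\<lambda>x. x) z =
          \<one>\<^bsub>grp E m (trivial_gspace {b}, {})\<^esub>}
     (carrier (grp E m (trivial_gspace {p}, {})))"
proof -
  interpret equivariant_cohomology_theory H E by (rule E)
  let ?i = "\<lambda>q. ind E m (trivial_gspace {q}, {}) (trivial_gspace {b, p}, {}) (\<lambda>x. x)"
  let ?G = "\<lambda>q. grp E m (trivial_gspace {q}, {})"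
  let ?U = "{{b}, {p}}"
  have sub: "gsub (trivial_gspace {b, p}) {q} = trivial_gspace {q}" if "q = b \<or> q = p" for q
    using that by (auto simp: gsub_trivial_gspace)
  have "bij_betw
     (\<lambda>z. \<lambda>V\<in>?U. ind E m (gsub (trivial_gspace {b, p}) V, {}) (trivial_gspace {b, p}, {}) (\<lambda>x. x) z)
     (carrier (grp E m (trivial_gspace {b, p}, {})))
     (\<Pi>\<^sub>E V\<in>?U. carrier (grp E m (gsub (trivial_gspace {b, p}) V, {})))"
  proof (rule additivity[OF is_gcw_trivial_gspace])
    show "subcomplex H (trivial_gspace {b, p}) (trivial_cells H {b, p}) V" if "V \<in> ?U" for V
      using that by (intro subcomplex_trivial_gspace) auto
  qed (use \<open>b \<noteq> p\<close> in \<open>auto simp: trivial_gspace_def disjoint_def\<close>)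
  \<comment> \<open>Additivity indexes the product by the subcomplexes; \<open>the_elem\<close>
    turns \<open>{q}\<close> back into \<open>q\<close>, so that both factors take the form
    \<open>?G q\<close>.\<close>
  then have bij: "bij_betw (\<lambda>z. \<lambda>V\<in>?U. ?i (the_elem V) z)
     (carrier (grp E m (trivial_gspace {b, p}, {}))) (\<Pi>\<^sub>E V\<in>?U. carrier (?G (the_elem V)))"
    (is "bij_betw ?F ?Z ?P")
  proof -
    have "(\<lambda>z. \<lambda>V\<in>?U. ind E m (gsub (trivial_gspace {b, p}) V, {}) (trivial_gspace {b, p}, {}) (\<lambda>x. x) z)
        = ?F"
      by (intro ext restrict_ext) (auto simp: sub)
    moreover have "(\<Pi>\<^sub>E V\<in>?U. carrier (grp E m (gsub (trivial_gspace {b, p}) V, {}))) = ?P"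
      by (intro PiE_cong) (auto simp: sub)
    moreover note \<open>bij_betw _ _ (\<Pi>\<^sub>E V\<in>?U. carrier (grp E m (gsub (trivial_gspace {b, p}) V, {})))\<close>
    ultimately show ?thesis by simp
  qed
  have one: "\<one>\<^bsub>?G b\<^esub> \<in> carrier (?G b)"
    using abelian_groups[OF gcw_pair_trivial_gspace]
    by (simp add: comm_group_def group.is_monoid monoid.one_closed)
  show ?thesis
  proof (rule bij_betwI')
    fix z z' assume z: "z \<in> {z \<in> ?Z. ?i b z = \<one>\<^bsub>?G b\<^esub>}" "z' \<in> {z \<in> ?Z. ?i b z = \<one>\<^bsub>?G b\<^esub>}"
    show "?i p z = ?i p z' \<longleftrightarrow> z = z'"
    proof
      assume "?i p z = ?i p z'"
      with z have "?F z = ?F z'"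
        by (intro restrict_ext) auto
      with z bij_betw_imp_inj_on[OF bij] show "z = z'"
        by (simp add: inj_on_def)
    qed simp
  next
    fix z assume "z \<in> {z \<in> ?Z. ?i b z = \<one>\<^bsub>?G b\<^esub>}"
    then have "?F z \<in> ?P"
      using bij_betwE[OF bij] by blast
    then have "?F z {p} \<in> carrier (?G (the_elem {p}))"
      by (rule PiE_mem) simp
    then show "?i p z \<in> carrier (?G p)" by simp
  next
    fix w assume w: "w \<in> carrier (?G p)"
    \<comment> \<open>The pair with unit entry at \<open>b\<close> and \<open>w\<close> at
      \<open>p\<close>; additivity realizes it by a class on both points.\<close>
    let ?f = "\<lambda>V\<in>?U. if V = {b} then \<one>\<^bsub>?G b\<^esub> else w"
    have "?f \<in> ?P"
      using one w \<open>b \<noteq> p\<close> by auto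
    then obtain z where z: "z \<in> ?Z" "?F z = ?f"
      using bij by (metis (no_types, lifting) bij_betw_imp_surj_on imageE)
    from fun_cong[OF z(2), of "{b}"] fun_cong[OF z(2), of "{p}"] \<open>b \<noteq> p\<close>
    show "\<exists>z\<in>{z \<in> ?Z. ?i b z = \<one>\<^bsub>?G b\<^esub>}. w = ?i p z"
      using z(1) by auto
  qed
qed

end

section \<open>Equivariant maps from a point and their homotopies\<close>

lemma gmap_trivial_gspace_singleton:
  "gmap H (trivial_gspace {p}) Y h \<longleftrightarrow> h p \<in> fixed_points (carrier H) Y"
  by (auto simp: gmap_def equivariant_def trivial_gspace_def fixed_points_def)

lemma homotopic_trivial_gspace_singleton:
  "homotopic_with (equivariant H (trivial_gspace {p}) Y) (sp (trivial_gspace {p})) (sp Y) h h' \<longleftrightarrow>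
     path_component_of (subtopology (sp Y) (fixed_points (carrier H) Y)) (h p) (h' p)"
    (is "?L \<longleftrightarrow> ?R")
proof
  assume ?L
  then obtain k where cont: "continuous_map (prod_topology (top_of_set {0..1::real}) (discrete_topology {p})) (sp Y) k"
    and k: "\<And>x. k (0, x) = h x" "\<And>x. k (1, x) = h' x"
    and equ: "\<And>t. t \<in> {0..1} \<Longrightarrow> equivariant H (trivial_gspace {p}) Y (\<lambda>x. k (t, x))"
    unfolding homotopic_with_def trivial_gspace_def gspace.simps by blast
  have "continuous_map (top_of_set {0..1}) (prod_topology (top_of_set {0..1::real}) (discrete_topology {p})) (\<lambda>t. (t, p))"
    by (simp add: continuous_map_pairwise o_def)
  from continuous_map_compose[OF this cont]
  have k_cont: "continuous_map (top_of_set {0..1}) (sp Y) (\<lambda>t. k (t, p))"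
    by (simp add: o_def)
  moreover have "k (t, p) \<in> fixed_points (carrier H) Y" if "t \<in> {0..1}" for t
  proof -
    have "k (t, p) \<in> topspace (sp Y)"
      using k_cont that by (auto simp: continuous_map_def)
    then show ?thesis
      using equ[OF that] by (simp add: equivariant_def trivial_gspace_def fixed_points_def)
  qed
  ultimately have "pathin (subtopology (sp Y) (fixed_points (carrier H) Y)) (\<lambda>t. k (t, p))"
    by (auto simp: pathin_def continuous_map_in_subtopology)
  then show ?R
    unfolding path_component_of_def using k by (intro exI[of _ "\<lambda>t. k (t, p)"]) simp
next
  assume ?R
  then obtain g where path: "pathin (subtopology (sp Y) (fixed_points (carrier H) Y)) g"
    and ends: "g 0 = h p" "g 1 = h' p"
    unfolding path_component_of_def by blast
  have g: "continuous_map (top_of_set {0..1}) (sp Y) g"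
    "\<forall>t\<in>{0..1}. g t \<in> fixed_points (carrier H) Y"
    using path by (auto simp: pathin_def continuous_map_in_subtopology Pi_iff)
  \<comment> \<open>\<open>homotopic_with\<close> prescribes the two end maps on the whole type. Off
    \<open>p\<close> the values are chosen only to match \<open>h\<close> and \<open>h'\<close> at
    times 0 and 1; continuity and equivariance see \<open>p\<close> alone.\<close>
  let ?k = "\<lambda>(t, x). if x = p then g t else if t = 0 then h x else h' x"
  have "continuous_map (prod_topology (top_of_set {0..1::real}) (discrete_topology {p})) (sp Y) (g \<circ> fst)"
    by (rule continuous_map_compose[OF continuous_map_fst g(1)])
  then have "continuous_map (prod_topology (top_of_set {0..1::real}) (discrete_topology {p})) (sp Y) ?k"
    by (rule continuous_map_eq) auto
  moreover have "equivariant H (trivial_gspace {p}) Y (\<lambda>x. ?k (t, x))" if "t \<in> {0..1}" for t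
    using bspec[OF g(2) that] by (simp add: equivariant_def trivial_gspace_def fixed_points_def)
  moreover have "?k (0, x) = h x" "?k (1, x) = h' x" for x
    using ends by auto
  ultimately show ?L
    unfolding homotopic_with_def trivial_gspace_def gspace.simps by (intro exI[of _ ?k]) blast
qed

lemma ghclass_trivial_gspace_singleton_eq_iff:
  assumes "h p \<in> fixed_points (carrier H) Y" "h' p \<in> fixed_points (carrier H) Y"
  shows "ghclass H (trivial_gspace {p}) Y h = ghclass H (trivial_gspace {p}) Y h' \<longleftrightarrow>
     path_component_of (subtopology (sp Y) (fixed_points (carrier H) Y)) (h p) (h' p)"
proof -
  let ?T = "subtopology (sp Y) (fixed_points (carrier H) Y)"
  have refl: "path_component_of ?T (h' p) (h' p)"
    using assms(2) by (simp add: path_component_of_refl fixed_points_def)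
  show ?thesis
    unfolding ghclass_def homotopic_trivial_gspace_singleton
    using refl by (auto simp: set_eq_iff intro: path_component_of_trans path_component_of_sym)
qed

text \<open>A homotopy class depends only on the value at \<open>p\<close>, so every class has a
  constant representative.\<close>

lemma ghclasses_trivial_gspace_singleton:
  "ghclasses H (trivial_gspace {p}) Y =
     (\<lambda>y. ghclass H (trivial_gspace {p}) Y (\<lambda>x. y)) ` fixed_points (carrier H) Y"
    (is "_ = ?c ` ?F")
proof (intro equalityI subsetI)
  fix C assume "C \<in> ghclasses H (trivial_gspace {p}) Y"
  then obtain h where h: "h p \<in> ?F" "C = ghclass H (trivial_gspace {p}) Y h"
    by (auto simp: ghclasses_def gmap_trivial_gspace_singleton)
  moreover have "path_component_of (subtopology (sp Y) ?F) (h p) (h p)"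
    using h(1) by (simp add: path_component_of_refl fixed_points_def)
  ultimately have "C = ?c (h p)"
    using ghclass_trivial_gspace_singleton_eq_iff[of h p H Y "\<lambda>x. h p"] by simp
  with h(1) show "C \<in> ?c ` ?F" by blast
next
  fix C assume "C \<in> ?c ` ?F"
  then show "C \<in> ghclasses H (trivial_gspace {p}) Y"
    by (auto simp: ghclasses_def gmap_trivial_gspace_singleton)
qed

section \<open>The representing space\<close>

lemma restrict_eq_iff: "(\<lambda>i\<in>I. f i) = (\<lambda>i\<in>I. g i) \<longleftrightarrow> (\<forall>i\<in>I. f i = g i)"
  by (metis restrict_apply' restrict_ext)

lemma bij_betw_PiE:
  assumes "\<And>i. i \<in> I \<Longrightarrow> bij_betw (f i) (A i) (B i)"
  shows "bij_betw (\<lambda>z. \<lambda>i\<in>I. f i (z i)) (\<Pi>\<^sub>E i\<in>I. A i) (\<Pi>\<^sub>E i\<in>I. B i)"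
proof (rule bij_betwI[where g = "\<lambda>w. \<lambda>i\<in>I. inv_into (A i) (f i) (w i)"])
  show "(\<lambda>z. \<lambda>i\<in>I. f i (z i)) \<in> Pi\<^sub>E I A \<rightarrow> Pi\<^sub>E I B"
    using bij_betwE[OF assms] by (auto simp: PiE_iff)
  show "(\<lambda>w. \<lambda>i\<in>I. inv_into (A i) (f i) (w i)) \<in> Pi\<^sub>E I B \<rightarrow> Pi\<^sub>E I A"
    using bij_betwE[OF bij_betw_inv_into[OF assms]] by (auto simp: PiE_iff)
next
  fix z assume z: "z \<in> Pi\<^sub>E I A"
  show "(\<lambda>i\<in>I. inv_into (A i) (f i) ((\<lambda>i\<in>I. f i (z i)) i)) = z"
  proof (rule PiE_ext[OF _ z])
    show "(\<lambda>i\<in>I. inv_into (A i) (f i) ((\<lambda>i\<in>I. f i (z i)) i)) \<in> Pi\<^sub>E I A"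
      using z bij_betw_inv_into_left[OF assms] by (simp add: PiE_iff)
    show "(\<lambda>i\<in>I. inv_into (A i) (f i) ((\<lambda>i\<in>I. f i (z i)) i)) i = z i" if "i \<in> I" for i
      using bij_betw_inv_into_left[OF assms[OF that] PiE_mem[OF z that]] that by simp
  qed
next
  fix w assume w: "w \<in> Pi\<^sub>E I B"
  show "(\<lambda>i\<in>I. f i ((\<lambda>i\<in>I. inv_into (A i) (f i) (w i)) i)) = w"
  proof (rule PiE_ext[OF _ w])
    show "(\<lambda>i\<in>I. f i ((\<lambda>i\<in>I. inv_into (A i) (f i) (w i)) i)) \<in> Pi\<^sub>E I B"
      using w bij_betw_inv_into_right[OF assms] by (simp add: PiE_iff)
    show "(\<lambda>i\<in>I. f i ((\<lambda>i\<in>I. inv_into (A i) (f i) (w i)) i)) i = w i" if "i \<in> I" for i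
      using bij_betw_inv_into_right[OF assms[OF that] PiE_mem[OF w that]] that by simp
  qed
qed

text \<open>The fibres of \<phi> are exactly the path components, so \<phi> descends to them
  independently of the chosen representative. The second clause keeps the values of the induced map
  available.\<close>

lemma bij_betw_path_components:
  assumes surj: "\<phi> ` topspace X = B"
    and eq: "\<And>f g. f \<in> topspace X \<Longrightarrow> g \<in> topspace X \<Longrightarrow> \<phi> f = \<phi> g \<longleftrightarrow> path_component_of X f g"
  shows "\<exists>\<Psi>. bij_betw \<Psi> (path_components_of X) B \<and>
    (\<forall>f\<in>topspace X. \<Psi> (path_component_of_set X f) = \<phi> f)"
proof -
  let ?\<Psi> = "\<lambda>C. \<phi> (SOME f. f \<in> C)"
  have \<Psi>: "?\<Psi> (path_component_of_set X f) = \<phi> f" if f: "f \<in> topspace X" for f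
  proof -
    have "f \<in> path_component_of_set X f"
      using f by (simp add: path_component_of_refl)
    then have some: "(SOME g. g \<in> path_component_of_set X f) \<in> path_component_of_set X f"
      by (rule someI)
    then have "(SOME g. g \<in> path_component_of_set X f) \<in> topspace X"
      using path_component_of_subset_topspace[of X f] by blast
    from eq[OF f this] some show ?thesis by simp
  qed
  have comps: "path_components_of X = path_component_of_set X ` topspace X"
    by (auto simp: path_components_of_def)
  have "bij_betw ?\<Psi> (path_components_of X) B"
    unfolding bij_betw_def
  proof
    show "inj_on ?\<Psi> (path_components_of X)"
    proof (rule inj_onI)
      fix C D assume "C \<in> path_components_of X" "D \<in> path_components_of X" and CD: "?\<Psi> C = ?\<Psi> D"
      then obtain f g where f: "f \<in> topspace X" "C = path_component_of_set X f"
        and g: "g \<in> topspace X" "D = path_component_of_set X g"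
        by (auto simp: comps)
      with CD have "\<phi> f = \<phi> g" by (simp only: \<Psi>)
      then have "path_component_of X f g" using eq f g by blast
      then have "path_component_of X f = path_component_of X g"
        using path_component_of_equiv[of X f g] by simp
      then show "C = D" using f g by simp
    qed
    show "?\<Psi> ` path_components_of X = B"
      unfolding comps surj[symmetric] image_image by (rule image_cong) (simp_all only: \<Psi>)
  qed
  with \<Psi> show ?thesis by blast
qed

lemma commuting_tuple_Gnz:
  assumes "topological_group G" "torsion_conj_reps G R" "\<sigma> \<in> Gnz G R n"
  shows "commuting_tuple G n \<sigma>"
proof -
  have "group G" "topspace (gtop G) = carrier G"
    using assms(1) by (simp_all add: topological_group_def)
  moreover have "\<sigma> i \<in> carrier G" if "i < n" for i
    using assms(2,3) that by (auto simp: Gnz_def torsion_conj_reps_def torsion_elements_def PiE_iff)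
  ultimately show ?thesis
    using assms(3) by (simp add: commuting_tuple_def commuting_tuple_axioms_def Gnz_def)
qed

text \<open>A bare bijection would only compare cardinalities. The second conjunct pins \<Phi> down:
  restricted to the point \<open>p\<close> away from the base point \<open>b\<close>, the
  \<sigma>-component of the class of \<open>f\<close> is what \<rho> assigns to the constant map at
  \<open>y\<close>, the point of \<open>Y\<close> that \<open>f\<close> encodes in that
  factor.\<close>

theorem theorem4p4:
  fixes G :: "'a topgrp" and R :: "'a set" and n :: nat and m :: int
    and E :: "('a \<times> (nat \<Rightarrow> real)) set topgrp \<Rightarrow> (('a \<times> (nat \<Rightarrow> real)) set, 'x, 'e) cohomology"
    and Y :: "(nat \<Rightarrow> 'a) \<Rightarrow> (('a \<times> (nat \<Rightarrow> real)) set, 'y) gspace"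
    and \<rho> :: "(nat \<Rightarrow> 'a) \<Rightarrow> (('a \<times> (nat \<Rightarrow> real)) set, 'x) gspace \<Rightarrow> ('x \<Rightarrow> 'y) set \<Rightarrow> 'e"
    and U :: "(nat \<Rightarrow> 'a) \<Rightarrow> 'a set \<Rightarrow> ('a set, 'u) gspace"
    and b p :: 'x
  assumes "compact_lie_group G" and "n > 0" and "torsion_conj_reps G R"
    and "\<And>\<sigma>. \<sigma> \<in> Gnz G R n \<Longrightarrow> equivariant_cohomology_theory (Lam G n \<sigma>) (E (Lam G n \<sigma>))"
    and "\<And>\<sigma>. \<sigma> \<in> Gnz G R n \<Longrightarrow> represents (Lam G n \<sigma>) (E (Lam G n \<sigma>)) m (Y \<sigma>) (\<rho> \<sigma>)"
    and "\<And>\<sigma> K. \<sigma> \<in> Gnz G R n \<Longrightarrow> K \<in> maximal_subgroups (Gam G n \<sigma>) \<Longrightarrow>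
           universal_space (quotient_topgrp (Gam G n \<sigma>) K) (U \<sigma> K)"
    and "b \<noteq> p"
  shows "\<exists>\<Phi>. bij_betw \<Phi> (pi0_fixed G (QE_space G R n U Y)) (QE_reduced G R n E m (S0 b p) b) \<and>
    (\<forall>f\<in>fixed_points (carrier G) (QE_space G R n U Y). \<forall>\<sigma>\<in>Gnz G R n. \<forall>y.
       f \<sigma> \<one>\<^bsub>G\<^esub> = join2_left y \<longrightarrow>
       QE_ind G R n E m (gsub (S0 b p) {p}) (S0 b p) (\<lambda>x. x)
         (\<Phi> (path_component_of_set
               (subtopology (sp (QE_space G R n U Y)) (fixed_points (carrier G) (QE_space G R n U Y))) f)) \<sigma> =
       \<rho> \<sigma> (fix_sigma n \<sigma> (gsub (S0 b p) {p}))
         (ghclass (Lam G n \<sigma>) (fix_sigma n \<sigma> (gsub (S0 b p) {p})) (Y \<sigma>) (\<lambda>x. y)))"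
proof -
  let ?I = "Gnz G R n"
  let ?L = "\<lambda>\<sigma>. Lam G n \<sigma>"
  let ?X = "subtopology (sp (QE_space G R n U Y)) (fixed_points (carrier G) (QE_space G R n U Y))"
  let ?pt = "trivial_gspace {p} :: (('a \<times> (nat \<Rightarrow> real)) set, 'x) gspace"
  let ?r = "QE_ind G R n E m (gsub (S0 b p) {p}) (S0 b p) (\<lambda>x. x)"
  let ?F = "\<lambda>\<sigma>. fixed_points (carrier (?L \<sigma>)) (Y \<sigma>)"
  let ?c = "\<lambda>\<sigma> y. \<rho> \<sigma> ?pt (ghclass (?L \<sigma>) ?pt (Y \<sigma>) (\<lambda>x. y))"
  let ?P = "\<Pi>\<^sub>E \<sigma>\<in>?I. carrier (grp (E (?L \<sigma>)) m (?pt, {}))"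
  let ?in = "\<lambda>y. \<lambda>x\<in>carrier G. join2_left y"
  let ?R = "\<lambda>\<sigma>. R_space G n \<sigma> (U \<sigma>) (Y \<sigma>)"
  have tg: "topological_group G"
    using assms(1) by (simp add: compact_lie_group_def)
  then interpret group G by (simp add: topological_group_def)
  have ct: "commuting_tuple G n \<sigma>" if "\<sigma> \<in> ?I" for \<sigma>
    using commuting_tuple_Gnz[OF tg assms(3) that] .
  have L: "group (?L \<sigma>)" "topspace (gtop (?L \<sigma>)) = carrier (?L \<sigma>)" if "\<sigma> \<in> ?I" for \<sigma>
    using commuting_tuple.group_Lam[OF ct[OF that]] commuting_tuple.topspace_Lam[OF ct[OF that]] .
  have YG: "is_gspace (?L \<sigma>) (Y \<sigma>)" if "\<sigma> \<in> ?I" for \<sigma>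
    using assms(5)[OF that] by (simp add: represents_def)
  have rho: "bij_betw (\<rho> \<sigma> ?pt) (ghclasses (?L \<sigma>) ?pt (Y \<sigma>)) (carrier (grp (E (?L \<sigma>)) m (?pt, {})))"
    if "\<sigma> \<in> ?I" for \<sigma>
  proof -
    have "gcw_complex (?L \<sigma>) ?pt"
      by (rule gcw_complex_trivial_gspace[OF L[OF that]])
    with assms(5)[OF that] show ?thesis
      unfolding represents_def by blast
  qed
  have fix_S0: "fix_sigma n \<sigma> (S0 b p) = trivial_gspace {b, p}"
    "fix_sigma n \<sigma> (gsub (S0 b p) {b}) = trivial_gspace {b}"
    "fix_sigma n \<sigma> (gsub (S0 b p) {p}) = trivial_gspace {p}" for \<sigma> :: "nat \<Rightarrow> 'a"
    by (simp_all add: S0_eq_trivial_gspace gsub_trivial_gspace fix_sigma_trivial_gspace)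

  \<comment> \<open>Restriction to \<open>p\<close> acts factor by factor, and so does the kernel
    condition, because the unit of a product group is the tuple of units.\<close>
  have "bij_betw ?r
      (\<Pi>\<^sub>E \<sigma>\<in>?I. {z \<in> carrier (grp (E (?L \<sigma>)) m (trivial_gspace {b, p}, {})).
        ind (E (?L \<sigma>)) m (trivial_gspace {b}, {}) (trivial_gspace {b, p}, {}) (\<lambda>x. x) z =
          \<one>\<^bsub>grp (E (?L \<sigma>)) m (trivial_gspace {b}, {})\<^esub>}) ?P"
      (is "bij_betw _ ?K _")
    unfolding QE_ind_def fix_S0
    by (rule bij_betw_PiE, rule bij_betw_reduced_S0[OF L assms(4) assms(7)])
  moreover have "QE_reduced G R n E m (S0 b p) b = ?K"
    by (auto simp: QE_reduced_def QE_group_def QE_ind_def kernel_def fix_S0 PiE_iff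
        restrict_def fun_eq_iff extensional_def)
  ultimately have r: "bij_betw ?r (QE_reduced G R n E m (S0 b p) b) ?P"
    by simp

  have Req: "fixed_points (carrier G) (?R \<sigma>) = ?in ` ?F \<sigma>" if "\<sigma> \<in> ?I" for \<sigma>
    using commuting_tuple.fixed_points_R_space[OF ct[OF that] assms(6)[OF that] YG[OF that]] .
  have fix_QE: "fixed_points (carrier G) (QE_space G R n U Y) = (\<Pi>\<^sub>E \<sigma>\<in>?I. ?in ` ?F \<sigma>)"
    unfolding QE_space_def fixed_points_gprod by (rule PiE_cong) (rule Req)
  have topX: "topspace ?X = (\<Pi>\<^sub>E \<sigma>\<in>?I. ?in ` ?F \<sigma>)"
    unfolding fix_QE[symmetric] by (auto simp: fixed_points_def)
  \<comment> \<open>The fixed-point space is itself a product of subspaces, which makes its path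
    relation componentwise.\<close>
  have X_eq: "?X = product_topology (\<lambda>\<sigma>. subtopology (sp (?R \<sigma>)) (fixed_points (carrier G) (?R \<sigma>))) ?I"
    unfolding QE_space_def fixed_points_gprod by (simp add: gprod_def subtopology_product_topology)

  \<comment> \<open>In each factor a fixed point is constant at some \<open>join2_left y\<close>;
    evaluation at the unit and \<open>the\<close> recover \<open>y\<close>.\<close>
  define \<phi> where "\<phi> f = (\<lambda>\<sigma>\<in>?I. ?c \<sigma> (the (fst (f \<sigma> \<one>\<^bsub>G\<^esub>))))"
    for f :: "(nat \<Rightarrow> 'a) \<Rightarrow> 'a \<Rightarrow>
        'y option \<times> ('a \<Rightarrow> ('a set \<Rightarrow> real) \<times> ('a set \<Rightarrow> 'u)) option \<times> real"
  have phi: "\<phi> (\<lambda>\<sigma>\<in>?I. ?in (y \<sigma>)) = (\<lambda>\<sigma>\<in>?I. ?c \<sigma> (y \<sigma>))" for y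
    unfolding \<phi>_def by (rule restrict_ext) simp
  have X_form: "\<exists>y\<in>(\<Pi> \<sigma>\<in>?I. ?F \<sigma>). f = (\<lambda>\<sigma>\<in>?I. ?in (y \<sigma>))" if f: "f \<in> topspace ?X" for f
  proof -
    have "\<forall>\<sigma>\<in>?I. \<exists>y. y \<in> ?F \<sigma> \<and> f \<sigma> = ?in y"
      using f unfolding topX by (auto simp: PiE_iff)
    then obtain y where y: "\<And>\<sigma>. \<sigma> \<in> ?I \<Longrightarrow> y \<sigma> \<in> ?F \<sigma>" "\<And>\<sigma>. \<sigma> \<in> ?I \<Longrightarrow> f \<sigma> = ?in (y \<sigma>)"
      by metis
    have "f \<in> extensional ?I"
      using f unfolding topX by (simp add: PiE_iff)
    then have "f = (\<lambda>\<sigma>\<in>?I. ?in (y \<sigma>))"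
      by (rule extensionalityI) (simp_all add: y(2))
    with y(1) show ?thesis by blast
  qed
  have c_eq: "?c \<sigma> y = ?c \<sigma> y' \<longleftrightarrow> path_component_of (subtopology (sp (Y \<sigma>)) (?F \<sigma>)) y y'"
    if \<sigma>: "\<sigma> \<in> ?I" and y: "y \<in> ?F \<sigma>" "y' \<in> ?F \<sigma>" for \<sigma> y y'
  proof -
    have "ghclass (?L \<sigma>) ?pt (Y \<sigma>) (\<lambda>x. z) \<in> ghclasses (?L \<sigma>) ?pt (Y \<sigma>)" if "z \<in> ?F \<sigma>" for z
      using that unfolding ghclasses_trivial_gspace_singleton by (rule imageI)
    \<comment> \<open>Injectivity of \<rho> reduces equality in cohomology to equality of homotopy
      classes, which for maps from a point is a path in the fixed points.\<close>
    then have "?c \<sigma> y = ?c \<sigma> y' \<longleftrightarrow>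
        ghclass (?L \<sigma>) ?pt (Y \<sigma>) (\<lambda>x. y) = ghclass (?L \<sigma>) ?pt (Y \<sigma>) (\<lambda>x. y')"
      using inj_on_eq_iff[OF bij_betw_imp_inj_on[OF rho[OF \<sigma>]]] y by blast
    also have "\<dots> \<longleftrightarrow> path_component_of (subtopology (sp (Y \<sigma>)) (?F \<sigma>)) y y'"
      using ghclass_trivial_gspace_singleton_eq_iff[of "\<lambda>x. y" p "?L \<sigma>" "Y \<sigma>" "\<lambda>x. y'"] y by simp
    finally show ?thesis .
  qed
  have c_surj: "?c \<sigma> ` ?F \<sigma> = carrier (grp (E (?L \<sigma>)) m (?pt, {}))" if \<sigma>: "\<sigma> \<in> ?I" for \<sigma>
    using bij_betw_imp_surj_on[OF rho[OF \<sigma>]]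
    unfolding ghclasses_trivial_gspace_singleton image_image .

  have phi_surj: "\<phi> ` topspace ?X = ?P"
  proof (intro equalityI subsetI)
    fix w assume "w \<in> \<phi> ` topspace ?X"
    then obtain f where f: "f \<in> topspace ?X" "w = \<phi> f" by blast
    obtain y where y: "y \<in> (\<Pi> \<sigma>\<in>?I. ?F \<sigma>)" "f = (\<lambda>\<sigma>\<in>?I. ?in (y \<sigma>))"
      using X_form[OF f(1)] by blast
    have "?c \<sigma> (y \<sigma>) \<in> carrier (grp (E (?L \<sigma>)) m (?pt, {}))" if "\<sigma> \<in> ?I" for \<sigma>
      unfolding c_surj[OF that, symmetric] by (rule imageI[OF Pi_mem[OF y(1) that]])
    then show "w \<in> ?P"
      unfolding f(2) y(2) phi by (simp add: PiE_iff)
  next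
    fix w assume w: "w \<in> ?P"
    have "\<exists>y. y \<in> ?F \<sigma> \<and> w \<sigma> = ?c \<sigma> y" if "\<sigma> \<in> ?I" for \<sigma>
      using PiE_mem[OF w that] unfolding c_surj[OF that, symmetric] by blast
    then obtain y where y: "\<And>\<sigma>. \<sigma> \<in> ?I \<Longrightarrow> y \<sigma> \<in> ?F \<sigma>" "\<And>\<sigma>. \<sigma> \<in> ?I \<Longrightarrow> w \<sigma> = ?c \<sigma> (y \<sigma>)"
      by metis
    have "w \<in> extensional ?I"
      using w by (simp add: PiE_iff)
    then have "w = (\<lambda>\<sigma>\<in>?I. ?c \<sigma> (y \<sigma>))"
      by (rule extensionalityI) (simp_all add: y(2))
    then have "w = \<phi> (\<lambda>\<sigma>\<in>?I. ?in (y \<sigma>))"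
      unfolding phi .
    moreover have "(\<lambda>\<sigma>\<in>?I. ?in (y \<sigma>)) \<in> topspace ?X"
      unfolding topX using y(1) by (simp add: PiE_iff)
    ultimately show "w \<in> \<phi> ` topspace ?X"
      by (rule image_eqI)
  qed
  have phi_eq: "\<phi> f = \<phi> g \<longleftrightarrow> path_component_of ?X f g"
    if f: "f \<in> topspace ?X" and g: "g \<in> topspace ?X" for f g
  proof -
    obtain y y' where y: "\<And>\<sigma>. \<sigma> \<in> ?I \<Longrightarrow> y \<sigma> \<in> ?F \<sigma>" "f = (\<lambda>\<sigma>\<in>?I. ?in (y \<sigma>))"
      and y': "\<And>\<sigma>. \<sigma> \<in> ?I \<Longrightarrow> y' \<sigma> \<in> ?F \<sigma>" "g = (\<lambda>\<sigma>\<in>?I. ?in (y' \<sigma>))"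
      using X_form[OF f] X_form[OF g] by (auto simp: Pi_iff)
    have "\<phi> f = \<phi> g \<longleftrightarrow> (\<forall>\<sigma>\<in>?I. ?c \<sigma> (y \<sigma>) = ?c \<sigma> (y' \<sigma>))"
      unfolding y(2) y'(2) phi by (rule restrict_eq_iff)
    also have "\<dots> \<longleftrightarrow> (\<forall>\<sigma>\<in>?I. path_component_of
        (subtopology (sp (?R \<sigma>)) (fixed_points (carrier G) (?R \<sigma>))) (?in (y \<sigma>)) (?in (y' \<sigma>)))"
    proof (rule ball_cong[OF refl])
      fix \<sigma> assume \<sigma>: "\<sigma> \<in> ?I"
      show "?c \<sigma> (y \<sigma>) = ?c \<sigma> (y' \<sigma>) \<longleftrightarrow> path_component_of
        (subtopology (sp (?R \<sigma>)) (fixed_points (carrier G) (?R \<sigma>))) (?in (y \<sigma>)) (?in (y' \<sigma>))"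
        unfolding c_eq[OF \<sigma> y(1)[OF \<sigma>] y'(1)[OF \<sigma>]]
        using commuting_tuple.path_component_of_R_space[OF ct[OF \<sigma>] assms(6)[OF \<sigma>] YG[OF \<sigma>]
            y(1)[OF \<sigma>] y'(1)[OF \<sigma>]] by (rule sym)
    qed
    also have "\<dots> \<longleftrightarrow> path_component_of ?X f g"
      unfolding X_eq by (subst path_component_of_product_topology) (simp_all add: y(2) y'(2))
    finally show ?thesis .
  qed
  obtain \<Psi> where \<Psi>: "bij_betw \<Psi> (path_components_of ?X) ?P"
    "\<forall>f\<in>topspace ?X. \<Psi> (path_component_of_set ?X f) = \<phi> f"
    using bij_betw_path_components[OF phi_surj phi_eq] by blast

  \<comment> \<open>\<Psi> takes values in the product of the groups at \<open>p\<close>; the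
    inverse of restriction lifts them to the reduced value, which lies inside the groups of both
    points.\<close>
  let ?\<Phi> = "inv_into (QE_reduced G R n E m (S0 b p) b) ?r \<circ> \<Psi>"
  have "bij_betw ?\<Phi> (pi0_fixed G (QE_space G R n U Y)) (QE_reduced G R n E m (S0 b p) b)"
    unfolding pi0_fixed_def by (rule bij_betw_trans[OF \<Psi>(1) bij_betw_inv_into[OF r]])
  moreover have "?r (?\<Phi> (path_component_of_set ?X f)) \<sigma> =
       \<rho> \<sigma> (fix_sigma n \<sigma> (gsub (S0 b p) {p}))
         (ghclass (?L \<sigma>) (fix_sigma n \<sigma> (gsub (S0 b p) {p})) (Y \<sigma>) (\<lambda>x. y))"
    if f: "f \<in> fixed_points (carrier G) (QE_space G R n U Y)" and \<sigma>: "\<sigma> \<in> ?I"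
      and y: "f \<sigma> \<one>\<^bsub>G\<^esub> = join2_left y" for f \<sigma> y
  proof -
    have fX: "f \<in> topspace ?X"
      unfolding topX using f unfolding fix_QE .
    then have "path_component_of_set ?X f \<in> path_components_of ?X"
      unfolding path_components_of_def by (rule imageI)
    then have "\<Psi> (path_component_of_set ?X f) \<in> ?P"
      using bij_betwE[OF \<Psi>(1)] by blast
    then have "?r (?\<Phi> (path_component_of_set ?X f)) = \<Psi> (path_component_of_set ?X f)"
      unfolding comp_apply by (rule bij_betw_inv_into_right[OF r])
    then have "?r (?\<Phi> (path_component_of_set ?X f)) \<sigma> = \<phi> f \<sigma>"
      unfolding bspec[OF \<Psi>(2) fX] by (rule fun_cong)
    also have "\<phi> f \<sigma> = ?c \<sigma> y"
      using \<sigma> y by (simp add: \<phi>_def)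
    finally show ?thesis
      unfolding fix_S0 .
  qed
  ultimately show ?thesis by blast
qed

end
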